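(* Let $m,N_0\ge 0$ be integers and let $q,C,x,A_1,\dots,A_m$ be nonzero complex numbers such that none of the denominators below vanish. For any $f(x)\in \mathcal{L}_{N_0}(P(x),Q(x))$ we have the expansion $$\bigg(\frac{C}{x}\bigg)^{N_0}\frac{(q,C^2q;q,p)_{m+N_0}}{(Cxq,Cq/x;q,p)_{m+N_0}}\,f(x)\prod_{i=1}^m\theta(A_ix,A_i/x;p)$$ $$=\sum_{k=0}^{m+N_0}q^{k(m+1)}\,\frac{\theta(C^2q^{2k};p)}{\theta(C^2;p)}\,\frac{(C^2,C/x,Cx,q^{-(m+N_0)};q,p)_{k}}{(q,Cxq,Cq/x,C^2q^{m+N_0+1};q,p)_{k}}\,f(Cq^k)\prod_{i=1}^m\theta(A_iCq^k,A_iq^{-k}/C;p).$$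
   Context: Let $p\in\mathbb{C}$, $|p|<1$. Write $(x;p)_\infty=\prod_{n=0}^\infty(1-xp^n)$. The modified Jacobi theta function is $\theta(x;p)=\prod_{n=0}^{\infty}(1-xp^n)(1-p^{n+1}/x)$ for $x\ne 0$, and $\theta(x_1,\dots,x_r;p)=\prod_{k=1}^r\theta(x_k;p)$. The theta $q,p$-shifted factorial is $(x;q,p)_n=\prod_{k=0}^{n-1}\theta(xq^k;p)$, and $(x_1,\dots,x_r;q,p)_n=\prod_{k=1}^r(x_k;q,p)_n$. Empty products equal $1$. Define $P(x)=\theta(-x^2;p^2)\,(-p;p)_\infty$ and $Q(x)=x\,\theta(-px^2;p^2)\,(-p;p)_\infty$ for $x\ne0$, where $\theta(-px^2;p^2)=\prod_{n\ge 0}(1+p^{2n+1}x^2)(1+p^{2n+1}/x^2)$. For an integer $M\ge 0$, $\mathcal{L}_M(P(x),Q(x))$ denotes the set of all functions of the form $\sum_{k=0}^{M}\lambda_kP(x)^kQ(x)^{M-k}$ with complex coefficients $\lambda_k$ independent of $x$ ("elliptic Askey-Wilson polynomials of degree $M$"). *)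

theory Defs
  imports "HOL-Analysis.Infinite_Products"
begin

definition qpoch_inf :: "complex \<Rightarrow> complex \<Rightarrow> complex" where
  "qpoch_inf x p = (\<Prod>n. 1 - x * p ^ n)"

definition mtheta :: "complex \<Rightarrow> complex \<Rightarrow> complex" where
  "mtheta x p = (\<Prod>n. (1 - x * p ^ n) * (1 - p ^ (n + 1) / x))"

definition mthetas :: "complex list \<Rightarrow> complex \<Rightarrow> complex" where
  "mthetas xs p = (\<Prod>x\<leftarrow>xs. mtheta x p)"

definition theta_fact :: "complex \<Rightarrow> complex \<Rightarrow> complex \<Rightarrow> nat \<Rightarrow> complex" where
  "theta_fact x q p n = (\<Prod>k<n. mtheta (x * q ^ k) p)"

definition theta_facts :: "complex list \<Rightarrow> complex \<Rightarrow> complex \<Rightarrow> nat \<Rightarrow> complex" where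
  "theta_facts xs q p n = (\<Prod>x\<leftarrow>xs. theta_fact x q p n)"

definition AW_P :: "complex \<Rightarrow> complex \<Rightarrow> complex" where
  "AW_P p x = mtheta (- (x\<^sup>2)) (p\<^sup>2) * qpoch_inf (- p) p"

definition AW_Q :: "complex \<Rightarrow> complex \<Rightarrow> complex" where
  "AW_Q p x = x * mtheta (- (p * x\<^sup>2)) (p\<^sup>2) * qpoch_inf (- p) p"

text \<open>
  For \<open>p = 0\<close> the first argument of \<open>mtheta\<close> in \<open>AW_Q\<close> is zero; the following product is then
  the intended reading, and it agrees with the definition.
\<close>

lemma mtheta_AW_Q:
  assumes "x \<noteq> 0"
  shows "mtheta (- (p * x\<^sup>2)) (p\<^sup>2) =
    (\<Prod>n. (1 + p ^ (2 * n + 1) * x\<^sup>2) * (1 + p ^ (2 * n + 1) / x\<^sup>2))"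
proof -
  have "(1 - (- (p * x\<^sup>2)) * (p\<^sup>2) ^ n) * (1 - (p\<^sup>2) ^ (n + 1) / (- (p * x\<^sup>2))) =
    (1 + p ^ (2 * n + 1) * x\<^sup>2) * (1 + p ^ (2 * n + 1) / x\<^sup>2)" for n
  proof (cases "p = 0")
    case False
    have "(p\<^sup>2) ^ n = p ^ (2 * n)" by (rule power_mult [symmetric])
    then have "(p\<^sup>2) ^ (n + 1) = p * p ^ (2 * n + 1)" by (simp add: power2_eq_square)
    with False \<open>(p\<^sup>2) ^ n = p ^ (2 * n)\<close> show ?thesis by (simp add: mult_ac)
  qed simp
  then show ?thesis
    unfolding mtheta_def by simp
qed

text \<open>
  Elliptic Askey--Wilson polynomials of degree \<open>M\<close> are functions on the nonzero complex numbers;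
  the value of \<open>f\<close> at \<open>0\<close> is unconstrained.
\<close>

definition AW_space :: "complex \<Rightarrow> nat \<Rightarrow> (complex \<Rightarrow> complex) set" where
  "AW_space p M = {f. \<exists>c :: nat \<Rightarrow> complex. \<forall>x. x \<noteq> 0 \<longrightarrow>
     f x = (\<Sum>k=0..M. c k * AW_P p x ^ k * AW_Q p x ^ (M - k))}"

end

theory Submission
  imports Defs "HOL-Library.Nat_Bijection" "HOL-Analysis.Uncountable_Sets"
begin

text \<open>
  The expansion is Lagrange interpolation on a projective line. Call a function a form of degree
  \<open>n\<close> if it is a homogeneous polynomial of degree \<open>n\<close> in \<open>P\<close> and \<open>Q\<close>. Such a form is a binary
  form evaluated along the curve \<open>x \<mapsto> (P(x), Q(x))\<close>, and a binary form of degree \<open>N\<close> is determined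
  by its values at \<open>N + 1\<close> points, no two of them proportional; \<open>binary_form_interpolation\<close> writes
  it in terms of the determinants \<open>W(a,b) = P(a) Q(b) - P(b) Q(a)\<close>.

  The link with theta functions is \<open>AW_wronskian\<close>: \<open>W(a,b) = b \<theta>(ab) \<theta>(a/b)\<close>. It follows from the
  Jacobi triple product: in the double series of the product \<open>\<theta>(ab) \<theta>(a/b)\<close>, the terms whose two
  indices have an even sum, and those where it is odd, each factor into a product of two theta
  series of nome \<open>p\<^sup>2\<close>, one in \<open>a\<close> and one in \<open>b\<close>. The triple product itself is the limit of a finite
  \<open>q\<close>-binomial identity, by Tannery's theorem.

  Consequently \<open>x \<theta>(A x) \<theta>(A/x) = W(A,x)\<close> is a linear form, and
  \<open>F(x) = x\<^sup>m f(x) \<Prod>\<theta>(A\<^sub>i x) \<theta>(A\<^sub>i/x)\<close> is a form of degree \<open>N = m + N\<^sub>0\<close>. Interpolation at the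
  points \<open>C q\<^sup>k\<close> with \<open>0 \<le> k \<le> N\<close> gives the claim, once the products of theta functions over all
  \<open>j \<noteq> k\<close> are rewritten as shifted factorials.

  Interpolation needs \<open>\<theta>(C\<^sup>2 q\<^sup>s) \<noteq> 0\<close> for \<open>1 \<le> s < 2 N\<close>, whereas the denominators in the
  theorem can be nonzero although \<open>\<theta>(C\<^sup>2 q\<^sup>s)\<close> vanishes for some \<open>s\<close> between \<open>1\<close> and \<open>N\<close>. Such values
  of \<open>C\<close> form a countable set, and both sides are continuous in \<open>C\<close> where the denominators do not
  vanish, so the generic case implies the general one.
\<close>

section \<open>Theta products: reflection, zeros and continuity\<close>

lemma convergent_qpoch:
  fixes x p :: complex
  assumes "norm p < 1"
  shows "convergent_prod (\<lambda>n. 1 - x * p ^ n)"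
proof (rule abs_convergent_prod_imp_convergent_prod)
  have "summable (\<lambda>n. norm x * norm p ^ n)"
    using assms by (intro summable_mult summable_geometric) auto
  then show "abs_convergent_prod (\<lambda>n. 1 - x * p ^ n)"
    unfolding abs_convergent_prod_conv_summable by (simp add: norm_mult norm_power)
qed

lemma qpoch_inf_zero [simp]: "qpoch_inf 0 p = 1"
  by (simp add: qpoch_inf_def)

lemma qpoch_inf_eq_0D:
  assumes "norm p < 1" "qpoch_inf x p = 0"
  shows "\<exists>n. x * p ^ n = 1"
  using prodinf_nonzero[OF convergent_qpoch[OF assms(1)], of x] assms(2)
  unfolding qpoch_inf_def by (metis right_minus_eq)

lemma one_minus_power_nonzero:
  fixes p :: complex
  assumes "norm p < 1"
  shows "1 - p ^ Suc n \<noteq> 0"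
proof
  assume "1 - p ^ Suc n = 0"
  then have "norm p ^ Suc n = 1" by (metis norm_one norm_power right_minus_eq)
  moreover have "norm p ^ Suc n \<le> norm p ^ 1"
    using assms by (intro power_decreasing) auto
  ultimately show False using assms by simp
qed

lemma qpoch_inf_self_nonzero:
  assumes "norm p < 1"
  shows "qpoch_inf p p \<noteq> 0"
  using qpoch_inf_eq_0D[OF assms, of p] one_minus_power_nonzero[OF assms] by auto

text \<open>
  The case \<open>x = 1\<close> is separate because splitting off the first factor of an infinite product by
  division requires that factor to be nonzero.
\<close>

lemma qpoch_inf_unfold:
  assumes "norm p < 1"
  shows "qpoch_inf x p = (1 - x) * qpoch_inf (x * p) p"
proof (cases "x = 1")
  case True
  have "(\<Prod>n. 1 - x * p ^ n) = 0"
    using convergent_prod_has_prod[OF convergent_qpoch[OF assms, of x]]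
    by (rule has_prod_zeroI[where n = 0]) (simp add: True)
  then show ?thesis using True by (simp add: qpoch_inf_def)
next
  case False
  have "prodinf (\<lambda>n. 1 - x * p ^ Suc n) = prodinf (\<lambda>n. 1 - x * p ^ n) / (1 - x * p ^ 0)"
    using False by (intro prodinf_split_head convergent_qpoch assms) auto
  then show ?thesis using False unfolding qpoch_inf_def by (simp add: field_simps)
qed

lemma qpoch_inf_mult:
  assumes "norm p < 1"
  shows "qpoch_inf x p * qpoch_inf y p = (\<Prod>n. (1 - x * p ^ n) * (1 - y * p ^ n))"
  unfolding qpoch_inf_def by (intro prodinf_mult convergent_qpoch assms)

lemma mtheta_eq_qpoch_inf:
  assumes "norm p < 1"
  shows "mtheta x p = qpoch_inf x p * qpoch_inf (p / x) p"
  unfolding mtheta_def qpoch_inf_mult[OF assms] by simp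

text \<open>
  Both sides are multiples of \<open>(px;p)\<^sub>\<infinity> (p/x;p)\<^sub>\<infinity>\<close>; only the first factor of \<open>(x;p)\<^sub>\<infinity>\<close>, respectively
  of \<open>(1/x;p)\<^sub>\<infinity>\<close>, changes under \<open>x \<mapsto> 1/x\<close>.
\<close>

lemma mtheta_inverse:
  assumes "norm p < 1" "x \<noteq> 0"
  shows "mtheta (1 / x) p = - mtheta x p / x"
proof -
  have "mtheta (1 / x) p = (1 - 1 / x) * (qpoch_inf (p / x) p * qpoch_inf (x * p) p)"
    using qpoch_inf_unfold[OF assms(1), of "1 / x"]
    by (simp add: mtheta_eq_qpoch_inf[OF assms(1)] mult_ac)
  moreover have "mtheta x p = (1 - x) * (qpoch_inf (p / x) p * qpoch_inf (x * p) p)"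
    using qpoch_inf_unfold[OF assms(1), of x]
    by (simp add: mtheta_eq_qpoch_inf[OF assms(1)] mult_ac)
  moreover have "1 - 1 / x = - (1 - x) / x"
    using assms(2) by (simp add: field_simps)
  ultimately show ?thesis by (simp only: times_divide_eq_left mult_minus_left)
qed

lemma mtheta_nome_0: "mtheta x 0 = 1 - x"
  using qpoch_inf_unfold[of 0 x] by (simp add: mtheta_eq_qpoch_inf)

text \<open>
  A convergent product vanishes only if one of its factors does, so the zeros are integer powers
  of \<open>p\<close>. Countability is all that is needed to avoid them by a perturbation.
\<close>

lemma countable_mtheta_zeros:
  assumes "norm p < 1"
  shows "countable {y. mtheta y p = 0}"
proof (rule countable_subset)
  show "{y. mtheta y p = 0} \<subseteq> range (\<lambda>n. inverse (p ^ n)) \<union> range (\<lambda>n. p ^ Suc n)"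
  proof safe
    fix y assume "mtheta y p = 0" and no: "y \<notin> range (\<lambda>n. p ^ Suc n)"
    then consider "qpoch_inf y p = 0" | "qpoch_inf (p / y) p = 0"
      by (auto simp: mtheta_eq_qpoch_inf[OF assms])
    then show "y \<in> range (\<lambda>n. inverse (p ^ n))"
    proof cases
      case 1
      then show ?thesis using qpoch_inf_eq_0D[OF assms] by (metis inverse_unique mult.commute rangeI)
    next
      case 2
      then obtain n where n: "p / y * p ^ n = 1" using qpoch_inf_eq_0D[OF assms] by blast
      then have "y = p ^ Suc n" by (cases "y = 0") (auto simp: field_simps)
      then show ?thesis using no by blast
    qed
  qed
qed auto

text \<open>
  On a disc the partial products converge uniformly by the Weierstrass test.
\<close>

lemma isCont_qpoch_inf:
  fixes x p :: complex
  assumes "norm p < 1"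
  shows "isCont (\<lambda>x. qpoch_inf x p) x"
proof -
  define A where "A = cball (0::complex) (norm x + 1)"
  have "uniformly_convergent_on A (\<lambda>N x. \<Sum>n<N. norm (- x * p ^ n))"
  proof (rule Weierstrass_m_test')
    show "summable (\<lambda>n. (norm x + 1) * norm p ^ n)"
      using assms by (intro summable_mult summable_geometric) auto
  qed (auto simp: A_def norm_mult norm_power intro!: mult_right_mono)
  then have "uniformly_convergent_on A (\<lambda>N x. \<Prod>n<N. 1 + (- x * p ^ n))"
    by (intro uniformly_convergent_on_prod continuous_intros) (auto simp: A_def)
  then obtain g where g: "uniform_limit A (\<lambda>N x. \<Prod>n<N. 1 - x * p ^ n) g sequentially"
    by (auto simp: uniformly_convergent_on_def)
  have "continuous_on A g"
    using g by (rule uniform_limit_theorem[rotated]) (auto intro!: continuous_intros always_eventually)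
  moreover have "g y = qpoch_inf y p" if "y \<in> A" for y
  proof (rule LIMSEQ_unique)
    show "(\<lambda>N. \<Prod>n<N. 1 - y * p ^ n) \<longlonglongrightarrow> g y"
      using tendsto_uniform_limitI[OF g that] .
    have "(\<lambda>n. 1 - y * p ^ n) has_prod qpoch_inf y p"
      unfolding qpoch_inf_def using convergent_qpoch[OF assms] by (rule convergent_prod_has_prod)
    then show "(\<lambda>N. \<Prod>n<N. 1 - y * p ^ n) \<longlonglongrightarrow> qpoch_inf y p"
      by (rule has_prod_imp_tendsto')
  qed
  ultimately have "continuous_on A (\<lambda>y. qpoch_inf y p)"
    by (simp cong: continuous_on_cong)
  then show ?thesis
    by (rule continuous_on_interior) (auto simp: A_def)
qed

lemma isCont_mtheta:
  assumes "norm p < 1" "isCont g c" "g c \<noteq> 0"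
  shows "isCont (\<lambda>c. mtheta (g c) p) c"
  unfolding mtheta_eq_qpoch_inf[OF assms(1)]
  by (intro continuous_intros isCont_o2[OF _ isCont_qpoch_inf] assms)

section \<open>The Jacobi triple product\<close>

definition jtp_term :: "complex \<Rightarrow> complex \<Rightarrow> int \<Rightarrow> complex" where
  "jtp_term p x k = (- x) powi k * p ^ nat (k * (k - 1) div 2)"

text \<open>
  Setting \<open>1/(p;p)\<^sub>k = 0\<close> for \<open>k < 0\<close> makes the recurrence \<open>rqpoch_minus_1\<close> valid for all integers,
  so that the finite triple product below can be summed over all of \<open>\<int>\<close> without boundary terms.
\<close>

definition rqpoch :: "complex \<Rightarrow> int \<Rightarrow> complex" where
  "rqpoch p k = (if k < 0 then 0 else 1 / (\<Prod>i<nat k. 1 - p ^ Suc i))"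

text \<open>
  The Gaussian binomial coefficient with upper index \<open>n + m\<close> and lower index \<open>m + k\<close>, in base \<open>p\<close>.
\<close>

definition jtp_coeff :: "complex \<Rightarrow> nat \<Rightarrow> nat \<Rightarrow> int \<Rightarrow> complex" where
  "jtp_coeff p n m k = (\<Prod>i<n + m. 1 - p ^ Suc i) * rqpoch p (int n - k) * rqpoch p (int m + k)"

lemma rqpoch_minus_1:
  assumes "norm p < 1"
  shows "rqpoch p (k - 1) = (1 - p powi k) * rqpoch p k"
proof (cases "k \<le> 0")
  case True
  then show ?thesis by (cases "k = 0") (auto simp: rqpoch_def)
next
  case False
  then obtain n where k: "k = int (Suc n)" by (metis not_le zero_less_imp_eq_int gr0_implies_Suc)
  have "1 - p powi k = 1 - p ^ Suc n"
    unfolding k by (simp only: power_int_of_nat)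
  moreover have "1 - p ^ Suc n \<noteq> 0" by (rule one_minus_power_nonzero[OF assms])
  ultimately show ?thesis using k by (simp add: rqpoch_def nat_add_distrib del: power_Suc)
qed

lemma jtp_term_powi:
  assumes "p \<noteq> 0"
  shows "jtp_term p x k = (- x) powi k * p powi (k * (k - 1) div 2)"
proof -
  have "0 \<le> k * (k - 1)" by (cases "k \<le> 0") (auto intro: mult_nonpos_nonpos)
  then show ?thesis by (simp add: jtp_term_def power_int_def)
qed

lemma jtp_term_plus_1:
  assumes "x \<noteq> 0" "p \<noteq> 0"
  shows "jtp_term p x (k + 1) = - x * p powi k * jtp_term p x k"
proof -
  have "(k + 1) * (k + 1 - 1) div 2 = k + k * (k - 1) div 2"
  proof -
    have "(k + 1) * (k + 1 - 1) = k * (k - 1) + k * 2" by (simp add: algebra_simps)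
    then show ?thesis by simp
  qed
  then show ?thesis
    unfolding jtp_term_powi[OF assms(2)] using assms by (simp add: power_int_add)
qed

lemma has_sum_int_shift:
  fixes f :: "int \<Rightarrow> 'a::{comm_monoid_add, topological_space}"
  assumes "(f has_sum S) UNIV"
  shows "((\<lambda>k. f (k + d)) has_sum S) UNIV"
proof -
  have "bij_betw (\<lambda>k. k + d) UNIV UNIV"
    by (rule bij_betw_byWitness[where f' = "\<lambda>k. k - d"]) auto
  from has_sum_reindex_bij_betw[OF this, of f S] assms show ?thesis by simp
qed

text \<open>
  A form of the \<open>q\<close>-binomial theorem. Multiplying by one more factor, on either side, adds to the
  series a multiple of itself shifted by one; comparing coefficients leaves the Pascal rule for
  Gaussian binomial coefficients.
\<close>

lemma finite_jtp:
  assumes p: "norm p < 1" "p \<noteq> 0" and x: "x \<noteq> 0"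
  shows "((\<lambda>k. jtp_coeff p n m k * jtp_term p x k) has_sum
           (\<Prod>i<n. 1 - x * p ^ i) * (\<Prod>i<m. 1 - p ^ Suc i / x)) UNIV"
proof (induction m)
  case 0
  show ?case
  proof (induction n)
    case 0
    have "((\<lambda>k. jtp_coeff p 0 0 k * jtp_term p x k) has_sum 1) {0}"
      by (intro has_sum_finiteI) (auto simp: jtp_coeff_def rqpoch_def jtp_term_def)
    also have "?this \<longleftrightarrow> ((\<lambda>k. jtp_coeff p 0 0 k * jtp_term p x k) has_sum 1) UNIV"
      by (intro has_sum_cong_neutral) (auto simp: jtp_coeff_def rqpoch_def)
    finally show ?case by simp
  next
    case (Suc n)
    let ?S = "(\<Prod>i<n. 1 - x * p ^ i)"
    have IH: "((\<lambda>k. jtp_coeff p n 0 k * jtp_term p x k) has_sum ?S) UNIV" using Suc by simp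
    then have "((\<lambda>k. jtp_coeff p n 0 (k - 1) * jtp_term p x (k - 1)) has_sum ?S) UNIV"
      using has_sum_int_shift[OF IH, of "- 1"] by simp
    then have "((\<lambda>k. - (x * p ^ n) * (jtp_coeff p n 0 (k - 1) * jtp_term p x (k - 1)))
        has_sum - (x * p ^ n) * ?S) UNIV"
      by (rule has_sum_cmult_right)
    from has_sum_add[OF IH this]
    have "((\<lambda>k. jtp_coeff p n 0 k * jtp_term p x k
         + - (x * p ^ n) * (jtp_coeff p n 0 (k - 1) * jtp_term p x (k - 1)))
        has_sum (\<Prod>i<Suc n. 1 - x * p ^ i)) UNIV" by (simp add: algebra_simps)
    also have "(\<lambda>k. jtp_coeff p n 0 k * jtp_term p x k
         + - (x * p ^ n) * (jtp_coeff p n 0 (k - 1) * jtp_term p x (k - 1))) =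
       (\<lambda>k. jtp_coeff p (Suc n) 0 k * jtp_term p x k)"
    proof
      fix k
      define Y where "Y = (\<Prod>i<n. 1 - p ^ Suc i)"
      define u where "u = rqpoch p (int n + 1 - k)"
      define v where "v = rqpoch p k"
      define t where "t = jtp_term p x (k - 1)"
      have t: "jtp_term p x k = - x * p powi (k - 1) * t"
        using jtp_term_plus_1[OF x p(2), of "k - 1"] by (simp add: t_def)
      have u: "rqpoch p (int n - k) = (1 - p powi (int n + 1 - k)) * u"
        using rqpoch_minus_1[OF p(1), of "int n + 1 - k"] by (simp add: u_def)
      have v: "rqpoch p (k - 1) = (1 - p powi k) * v"
        using rqpoch_minus_1[OF p(1), of k] by (simp add: v_def)
      have c1: "jtp_coeff p n 0 k = Y * ((1 - p powi (int n + 1 - k)) * u) * v"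
        by (simp add: jtp_coeff_def Y_def u v_def)
      have c2: "jtp_coeff p n 0 (k - 1) = Y * u * ((1 - p powi k) * v)"
      proof -
        have "int n - (k - 1) = int n + 1 - k" "int 0 + (k - 1) = k - 1" "n + 0 = n" by simp_all
        then show ?thesis unfolding jtp_coeff_def Y_def u_def by (simp only: v)
      qed
      have c3: "jtp_coeff p (Suc n) 0 k = Y * (1 - p ^ Suc n) * u * v"
        by (simp add: jtp_coeff_def Y_def u_def v_def add.commute)
      have e1: "p powi (int n + 1 - k) * p powi (k - 1) = p ^ n"
        using p(2) by (simp add: power_int_add[symmetric])
      have e2: "p powi k = p * p powi (k - 1)"
        using p(2) by (simp add: power_int_diff)
      show "jtp_coeff p n 0 k * jtp_term p x k
         + - (x * p ^ n) * (jtp_coeff p n 0 (k - 1) * jtp_term p x (k - 1)) =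
         jtp_coeff p (Suc n) 0 k * jtp_term p x k"
      proof -
        have "Y * ((1 - s) * u) * v * (- x * r * t) + - (x * z) * (Y * u * ((1 - p * r) * v) * t)
            = Y * (1 - p * z) * u * v * (- x * r * t)" if "s * r = z" for r s z
          unfolding that[symmetric] by (simp add: algebra_simps)
        from this[OF e1] show ?thesis
          unfolding c1 c2 c3 t t_def[symmetric] e2 power_Suc .
      qed
    qed
    finally show ?case by simp
  qed
next
  case (Suc m)
  let ?S = "(\<Prod>i<n. 1 - x * p ^ i) * (\<Prod>i<m. 1 - p ^ Suc i / x)"
  from Suc have "((\<lambda>k. jtp_coeff p n m (k + 1) * jtp_term p x (k + 1)) has_sum ?S) UNIV"
    by (rule has_sum_int_shift)
  then have "((\<lambda>k. - (p ^ Suc m / x) * (jtp_coeff p n m (k + 1) * jtp_term p x (k + 1)))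
      has_sum - (p ^ Suc m / x) * ?S) UNIV"
    by (rule has_sum_cmult_right)
  from has_sum_add[OF Suc this]
  have "((\<lambda>k. jtp_coeff p n m k * jtp_term p x k
       + - (p ^ Suc m / x) * (jtp_coeff p n m (k + 1) * jtp_term p x (k + 1)))
      has_sum (\<Prod>i<n. 1 - x * p ^ i) * (\<Prod>i<Suc m. 1 - p ^ Suc i / x)) UNIV"
    by (simp add: algebra_simps)
  also have "(\<lambda>k. jtp_coeff p n m k * jtp_term p x k
       + - (p ^ Suc m / x) * (jtp_coeff p n m (k + 1) * jtp_term p x (k + 1))) =
     (\<lambda>k. jtp_coeff p n (Suc m) k * jtp_term p x k)"
  proof
    fix k
    define Y where "Y = (\<Prod>i<n + m. 1 - p ^ Suc i)"
    define u where "u = rqpoch p (int n - k)"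
    define v where "v = rqpoch p (int m + k + 1)"
    define t where "t = jtp_term p x k"
    have t: "jtp_term p x (k + 1) = - x * p powi k * t"
      using jtp_term_plus_1[OF x p(2), of k] by (simp add: t_def)
    have u: "rqpoch p (int n - (k + 1)) = (1 - p powi (int n - k)) * u"
      using rqpoch_minus_1[OF p(1), of "int n - k"] by (simp add: u_def algebra_simps)
    have v: "rqpoch p (int m + k) = (1 - p powi (int m + k + 1)) * v"
      using rqpoch_minus_1[OF p(1), of "int m + k + 1"] by (simp add: v_def)
    have c1: "jtp_coeff p n m k = Y * u * ((1 - p powi (int m + k + 1)) * v)"
      by (simp add: jtp_coeff_def Y_def u_def v)
    have c2: "jtp_coeff p n m (k + 1) = Y * ((1 - p powi (int n - k)) * u) * v"
      using u by (simp add: jtp_coeff_def Y_def v_def add.assoc)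
    have c3: "jtp_coeff p n (Suc m) k = Y * (1 - p ^ Suc (n + m)) * u * v"
      by (simp add: jtp_coeff_def Y_def u_def v_def algebra_simps)
    have e1: "p ^ Suc m * p powi k = p powi (int m + k + 1)"
      using p(2) by (simp add: power_int_add)
    have e2: "p powi (int m + k + 1) * p powi (int n - k) = p ^ Suc (n + m)"
    proof -
      have "p powi (int m + k + 1) * p powi (int n - k) = p powi (int m + k + 1 + (int n - k))"
        using p(2) by (simp only: power_int_add simp_thms)
      also have "int m + k + 1 + (int n - k) = int (Suc (n + m))" by simp
      finally show ?thesis by (simp only: power_int_of_nat)
    qed
    have "p ^ Suc m / x * jtp_term p x (k + 1) = - (p ^ Suc m * p powi k) * t"
      unfolding t using x by simp
    also have "\<dots> = - (p powi (int m + k + 1)) * t" using e1 by simp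
    finally have e3: "p ^ Suc m / x * jtp_term p x (k + 1) = - (p powi (int m + k + 1)) * t" .
    have "jtp_coeff p n m k * jtp_term p x k
       + - (p ^ Suc m / x) * (jtp_coeff p n m (k + 1) * jtp_term p x (k + 1))
       = jtp_coeff p n m k * t - jtp_coeff p n m (k + 1) * (p ^ Suc m / x * jtp_term p x (k + 1))"
      by (simp add: t_def algebra_simps)
    also have "\<dots> = jtp_coeff p n (Suc m) k * t"
    proof -
      have "Y * u * ((1 - r) * v) * t - Y * ((1 - s) * u) * v * (- r * t) = Y * (1 - z) * u * v * t"
        if "r * s = z" for r s z
        unfolding that[symmetric] by (simp add: algebra_simps)
      from this[OF e2] show ?thesis unfolding c1 c2 c3 e3 .
    qed
    finally show "jtp_coeff p n m k * jtp_term p x k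
       + - (p ^ Suc m / x) * (jtp_coeff p n m (k + 1) * jtp_term p x (k + 1)) =
       jtp_coeff p n (Suc m) k * jtp_term p x k" by (simp add: t_def)
  qed
  finally show ?case .
qed

lemma tendsto_qpoch_self:
  assumes "norm p < 1"
  shows "(\<lambda>n. \<Prod>i<n. 1 - p ^ Suc i) \<longlonglongrightarrow> qpoch_inf p p"
proof -
  have "(\<lambda>n. 1 - p * p ^ n) has_prod qpoch_inf p p"
    unfolding qpoch_inf_def using convergent_qpoch[OF assms] by (rule convergent_prod_has_prod)
  then show ?thesis using has_prod_imp_tendsto' by simp
qed

lemma tendsto_rqpoch:
  assumes "norm p < 1"
  shows "(\<lambda>n. rqpoch p (int n + k)) \<longlonglongrightarrow> 1 / qpoch_inf p p"
proof -
  have "filterlim (\<lambda>n. nat (int n + k)) sequentially sequentially"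
    unfolding filterlim_at_top
  proof
    fix Z
    show "\<forall>\<^sub>F n in sequentially. Z \<le> nat (int n + k)"
      using eventually_ge_at_top[of "Z + nat \<bar>k\<bar>"] by eventually_elim linarith
  qed
  then have "(\<lambda>n. 1 / (\<Prod>i<nat (int n + k). 1 - p ^ Suc i)) \<longlonglongrightarrow> 1 / qpoch_inf p p"
    by (intro tendsto_divide tendsto_const qpoch_inf_self_nonzero[OF assms]
          filterlim_compose[OF tendsto_qpoch_self[OF assms]])
  moreover have "\<forall>\<^sub>F n in sequentially. 1 / (\<Prod>i<nat (int n + k). 1 - p ^ Suc i) = rqpoch p (int n + k)"
    using eventually_ge_at_top[of "nat \<bar>k\<bar>"] by eventually_elim (auto simp: rqpoch_def)
  ultimately show ?thesis by (rule Lim_transform_eventually)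
qed

text \<open>
  The domination required by Tannery's theorem: \<open>(p;p)\<^sub>n\<close> converges to a nonzero limit, so it and its
  reciprocal are bounded.
\<close>

lemma jtp_coeff_bound:
  assumes "norm p < 1"
  obtains K where "\<And>n m k. norm (jtp_coeff p n m k) \<le> K"
proof -
  obtain A where A: "A > 0" "\<And>n. norm (\<Prod>i<n. 1 - p ^ Suc i) \<le> A"
    using convergent_imp_Bseq[OF convergentI[OF tendsto_qpoch_self[OF assms]]] by (auto elim: BseqE)
  obtain B where B: "B > 0" "\<And>n. norm (rqpoch p (int n)) \<le> B"
    using convergent_imp_Bseq[OF convergentI[OF tendsto_rqpoch[OF assms, of 0]]] by (auto elim: BseqE)
  have B': "norm (rqpoch p k) \<le> B" for k
    using B(1) B(2)[of "nat k"] by (cases "k < 0") (auto simp: rqpoch_def)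
  have "norm (jtp_coeff p n m k) \<le> A * B * B" for n m k
    unfolding jtp_coeff_def norm_mult
    using A B(1) B' by (intro mult_mono) auto
  then show ?thesis by (rule that)
qed

text \<open>
  Reflection of the index exchanges \<open>x\<close> and \<open>p/x\<close>, which reduces summability over the negative
  integers to summability over the naturals.
\<close>

lemma jtp_term_uminus:
  assumes "x \<noteq> 0" "p \<noteq> 0"
  shows "jtp_term p x (- int n) = jtp_term p (p / x) (int n)"
proof -
  have "- int n * (- int n - 1) = int n * (int n - 1) + int n * 2" by (simp add: algebra_simps)
  then have e: "- int n * (- int n - 1) div 2 = int n * (int n - 1) div 2 + int n" by simp
  have "0 \<le> int n * (int n - 1) div 2" by (cases n) auto
  then have "p ^ nat (- int n * (- int n - 1) div 2) = p ^ n * p ^ nat (int n * (int n - 1) div 2)"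
    unfolding e by (simp add: nat_add_distrib power_add)
  moreover have "(- x) powi (- int n) * p ^ n = (- (p / x)) ^ n"
  proof -
    have "- (p / x) = p * inverse (- x)" by (simp add: field_simps)
    then show ?thesis by (simp only: power_int_minus power_int_of_nat power_mult_distrib power_inverse mult.commute)
  qed
  ultimately show ?thesis by (simp add: jtp_term_def)
qed

lemma summable_jtp_term_nat:
  assumes "norm p < 1" "x \<noteq> 0" "p \<noteq> 0"
  shows "summable (\<lambda>n. norm (jtp_term p x (int n)))"
proof -
  have "(\<lambda>n. norm x * norm p ^ n) \<longlonglongrightarrow> norm x * 0"
    using assms by (intro tendsto_intros LIMSEQ_power_zero) auto
  then have "\<forall>\<^sub>F n in sequentially. norm x * norm p ^ n < 1 / 2"
    by (intro order_tendstoD(2)[where y = "norm x * 0"]) auto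
  then obtain N where N: "\<And>n. n \<ge> N \<Longrightarrow> norm x * norm p ^ n < 1 / 2"
    by (auto simp: eventually_sequentially)
  show ?thesis
  proof (rule summable_ratio_test[where c = "1 / 2" and N = N])
    fix n assume "n \<ge> N"
    have "norm (jtp_term p x (int (Suc n))) = (norm x * norm p ^ n) * norm (jtp_term p x (int n))"
      using jtp_term_plus_1[OF assms(2,3), of "int n"] by (simp add: norm_mult norm_power add.commute)
    also have "\<dots> \<le> 1 / 2 * norm (jtp_term p x (int n))"
      using N[OF \<open>n \<ge> N\<close>] by (intro mult_right_mono) auto
    finally show "norm (norm (jtp_term p x (int (Suc n)))) \<le> 1 / 2 * norm (norm (jtp_term p x (int n)))"
      by simp
  qed simp
qed

lemma summable_jtp_term:
  assumes "norm p < 1" "x \<noteq> 0" "p \<noteq> 0"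
  shows "(\<lambda>k. norm (jtp_term p x k)) summable_on UNIV"
proof -
  have nat: "(\<lambda>n. norm (jtp_term p y (int n))) summable_on UNIV" if "y \<noteq> 0" for y
    using summable_jtp_term_nat[OF assms(1) that assms(3)]
    by (intro norm_summable_imp_summable_on) auto
  have "(\<lambda>k. norm (jtp_term p x k)) summable_on (range int)"
    using nat[OF assms(2)] by (subst summable_on_reindex) (auto simp: o_def)
  moreover have "(\<lambda>k. norm (jtp_term p x k)) summable_on (range (\<lambda>n. - int n))"
    using nat[of "p / x"] assms
    by (subst summable_on_reindex) (auto simp: o_def jtp_term_uminus inj_on_def)
  ultimately have "(\<lambda>k. norm (jtp_term p x k)) summable_on (range int \<union> range (\<lambda>n. - int n))"
    by (rule summable_on_union)
  also have "range int \<union> range (\<lambda>n. - int n) = UNIV"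
    by (auto simp: image_iff) (metis int_cases2)
  finally show ?thesis .
qed

text \<open>
  For \<open>m = n \<rightarrow> \<infinity>\<close> in \<open>finite_jtp\<close> every coefficient tends to \<open>1/(p;p)\<^sub>\<infinity>\<close>. Tannery's theorem, applied
  along an enumeration of \<open>\<int>\<close>, allows the limit to be taken term by term.
\<close>

theorem jacobi_triple_product:
  assumes p: "norm p < 1" "p \<noteq> 0" and x: "x \<noteq> 0"
  shows "(jtp_term p x has_sum qpoch_inf p p * mtheta x p) UNIV"
proof -
  define a where "a i n = jtp_coeff p n n (int_decode i) * jtp_term p x (int_decode i)" for i n
  define b where "b i = 1 / qpoch_inf p p * jtp_term p x (int_decode i)" for i
  obtain K where K: "\<And>n m k. norm (jtp_coeff p n m k) \<le> K" using jtp_coeff_bound[OF p(1)] by blast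
  have summ: "summable (\<lambda>i. norm (jtp_term p x (int_decode i)))"
    using summable_jtp_term[OF p(1) x p(2)] summable_on_reindex_bij_betw[OF bij_int_decode]
    by (intro summable_on_imp_summable) fast
  have lim: "a i \<longlonglongrightarrow> b i" for i
  proof -
    define k where "k = int_decode i"
    have "(\<lambda>n. \<Prod>i<n + n. 1 - p ^ Suc i) \<longlonglongrightarrow> qpoch_inf p p"
      by (rule filterlim_compose[OF tendsto_qpoch_self[OF p(1)]])
         (auto intro!: filterlim_subseq simp: strict_mono_def)
    moreover have "(\<lambda>n. rqpoch p (int n - k)) \<longlonglongrightarrow> 1 / qpoch_inf p p"
      using tendsto_rqpoch[OF p(1), of "- k"] by simp
    moreover note tendsto_rqpoch[OF p(1), of k]
    ultimately have "a i \<longlonglongrightarrow> qpoch_inf p p * (1 / qpoch_inf p p) * (1 / qpoch_inf p p) * jtp_term p x k"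
      unfolding a_def jtp_coeff_def k_def by (intro tendsto_intros)
    then show ?thesis using qpoch_inf_self_nonzero[OF p(1)] by (simp add: b_def k_def)
  qed
  have "(\<lambda>n. suminf (\<lambda>i. a i n)) \<longlonglongrightarrow> suminf b"
  proof -
    have "\<forall>\<^sub>F (i, n) in sequentially \<times>\<^sub>F sequentially.
            norm (a i n) \<le> K * norm (jtp_term p x (int_decode i))"
      using K by (intro always_eventually) (auto simp: a_def norm_mult intro!: mult_right_mono)
    from tannerys_theorem[OF lim this summable_mult[OF summ]] show ?thesis by simp
  qed
  moreover have "suminf (\<lambda>i. a i n) = (\<Prod>i<n. (1 - x * p ^ i) * (1 - p ^ (i + 1) / x))" for n
  proof -
    have "((\<lambda>i. a i n) has_sum (\<Prod>i<n. 1 - x * p ^ i) * (\<Prod>i<n. 1 - p ^ Suc i / x)) UNIV"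
      unfolding a_def
      using finite_jtp[OF p x, of n n] has_sum_reindex_bij_betw[OF bij_int_decode] by fast
    then show ?thesis
      by (simp add: has_sum_imp_sums sums_unique[symmetric] prod.distrib)
  qed
  moreover have "(\<lambda>n. \<Prod>i<n. (1 - x * p ^ i) * (1 - p ^ (i + 1) / x)) \<longlonglongrightarrow> mtheta x p"
  proof (rule has_prod_imp_tendsto')
    have "convergent_prod (\<lambda>i. (1 - x * p ^ i) * (1 - (p / x) * p ^ i))"
      by (intro convergent_prod_mult convergent_qpoch p)
    then show "(\<lambda>i. (1 - x * p ^ i) * (1 - p ^ (i + 1) / x)) has_prod mtheta x p"
      unfolding mtheta_def by (intro convergent_prod_has_prod) simp
  qed
  ultimately have sb: "suminf b = mtheta x p" by (simp add: LIMSEQ_unique)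
  have "summable (\<lambda>i. norm (b i))"
    unfolding b_def norm_mult by (intro summable_mult summ)
  then have "(b has_sum mtheta x p) UNIV"
    using summable_norm_cancel sb by (intro norm_summable_imp_has_sum) (auto simp: sums_iff)
  then have "((\<lambda>i. qpoch_inf p p * b i) has_sum qpoch_inf p p * mtheta x p) UNIV"
    by (rule has_sum_cmult_right)
  then have "((\<lambda>i. jtp_term p x (int_decode i)) has_sum qpoch_inf p p * mtheta x p) UNIV"
    using qpoch_inf_self_nonzero[OF p(1)] by (simp add: b_def)
  then show ?thesis using has_sum_reindex_bij_betw[OF bij_int_decode] by fast
qed

section \<open>The two-dimensional space spanned by \<open>P\<close> and \<open>Q\<close>\<close>

lemma has_sum_complex_product:
  fixes f :: "'a \<Rightarrow> complex" and g :: "'b \<Rightarrow> complex"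
  assumes f: "(f has_sum S) A" and g: "(g has_sum T) B"
  shows "((\<lambda>(x, y). f x * g y) has_sum S * T) (A \<times> B)"
proof (rule has_sum_SigmaI)
  show "((\<lambda>y. case (x, y) of (x, y) \<Rightarrow> f x * g y) has_sum f x * T) B" for x
    using has_sum_cmult_right[OF g, of "f x"] by simp
  show "((\<lambda>x. f x * T) has_sum S * T) A"
    by (rule has_sum_cmult_left[OF f])
  have "f abs_summable_on A" "g abs_summable_on B"
    using f g has_sum_imp_summable summable_on_iff_abs_summable_on_complex by blast+
  then have "(\<lambda>(x, y). f x * g y) abs_summable_on A \<times> B"
    unfolding abs_summable_on_Sigma_iff
    by (auto simp: norm_mult infsum_cmult_right' abs_mult intro!: summable_on_cmult_right summable_on_cmult_left)
  then show "(\<lambda>(x, y). f x * g y) summable_on A \<times> B"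
    by (rule abs_summable_summable)
qed

text \<open>
  This identity explains the factor \<open>(-p;p)\<^sub>\<infinity>\<close> in \<open>P\<close> and \<open>Q\<close>: it turns the normalisation of the
  theta series of nome \<open>p\<^sup>2\<close> into that of nome \<open>p\<close>.
\<close>

lemma qpoch_inf_double:
  assumes "norm p < 1"
  shows "qpoch_inf (p\<^sup>2) (p\<^sup>2) = qpoch_inf p p * qpoch_inf (- p) p"
  unfolding qpoch_inf_mult[OF assms] unfolding qpoch_inf_def
  by (rule arg_cong[where f = prodinf])
     (auto simp: fun_eq_iff algebra_simps power2_eq_square power_mult_distrib)

lemma power_int_sum_difference:
  fixes x y :: "'a::field"
  assumes "x \<noteq> 0" "y \<noteq> 0"
  shows "x powi (n + m) * y powi (n - m) = (x * y) powi n * (x / y) powi m"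
  using assms by (simp add: power_int_add power_int_diff power_int_mult_distrib power_int_divide_distrib)

text \<open>
  With \<open>t(k) = k (k - 1) / 2\<close>, the exponents of \<open>p\<close> satisfy \<open>t(n + m) + t(n - m) = 2 t(n) + 2 t(m) + m\<close>,
  which has no mixed term in \<open>n\<close> and \<open>m\<close>; hence the variables separate.
\<close>

lemma jtp_term_product_even:
  assumes "p \<noteq> 0" "a \<noteq> 0" "b \<noteq> 0"
  shows "jtp_term p (a * b) (n + m) * jtp_term p (a / b) (n - m)
       = jtp_term (p\<^sup>2) (- (a\<^sup>2)) n * jtp_term (p\<^sup>2) (- (p * b\<^sup>2)) m"
proof -
  define t where "t k = k * (k - 1) div 2" for k :: int
  have t2: "2 * t k = k * (k - 1)" for k by (simp add: t_def)
  have "2 * (t (n + m) + t (n - m)) = 2 * (2 * t n + m + 2 * t m)"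
    unfolding distrib_left t2 by (simp add: t2 algebra_simps)
  then have e: "t (n + m) + t (n - m) = 2 * t n + m + 2 * t m" by simp
  have "(- (a * b)) powi (n + m) * (- (a / b)) powi (n - m)
      = ((- (a * b)) * (- (a / b))) powi n * ((- (a * b)) / (- (a / b))) powi m"
    using assms by (intro power_int_sum_difference) auto
  also have "\<dots> = (a\<^sup>2) powi n * (b\<^sup>2) powi m"
    using assms by (simp add: power2_eq_square)
  finally have s: "(- (a * b)) powi (n + m) * (- (a / b)) powi (n - m) = (a\<^sup>2) powi n * (b\<^sup>2) powi m" .
  have "jtp_term p (a * b) (n + m) * jtp_term p (a / b) (n - m)
      = (a\<^sup>2) powi n * (b\<^sup>2) powi m * p powi (t (n + m) + t (n - m))"
    unfolding jtp_term_powi[OF assms(1)] t_def[symmetric]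
    using assms(1) s by (simp add: power_int_add)
  also have "\<dots> = (a\<^sup>2) powi n * (p\<^sup>2) powi t n * ((p * b\<^sup>2) powi m * (p\<^sup>2) powi t m)"
    using assms(1) unfolding e
    by (simp add: power_int_add power_int_mult_distrib power_int_mult)
  finally show ?thesis
    using assms(1) by (simp add: jtp_term_powi t_def)
qed

text \<open>
  The index pairs with odd sum, parametrised so that the exponent of \<open>p\<close> is again
  \<open>2 t(n) + 2 t(m) + m\<close>, with the roles of \<open>a\<close> and \<open>b\<close> exchanged.
\<close>

lemma jtp_term_product_odd:
  assumes "p \<noteq> 0" "a \<noteq> 0" "b \<noteq> 0"
  shows "b * (jtp_term p (a * b) (m + n) * jtp_term p (a / b) (m + 1 - n))
       = - (jtp_term (p\<^sup>2) (- (b\<^sup>2)) n * (a * jtp_term (p\<^sup>2) (- (p * a\<^sup>2)) m))"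
proof -
  define t where "t k = k * (k - 1) div 2" for k :: int
  have t2: "2 * t k = k * (k - 1)" for k by (simp add: t_def)
  have "2 * (t (m + n) + t (m + 1 - n)) = 2 * (2 * t n + m + 2 * t m)"
    unfolding distrib_left t2 by (simp add: t2 algebra_simps)
  then have e: "t (m + n) + t (m + 1 - n) = 2 * t n + m + 2 * t m" by simp
  have "(- (a * b)) powi (m + n) * (- (a / b)) powi (m + 1 - n)
      = - (a / b) * ((- (a * b)) * (- (a / b))) powi m * ((- (a * b)) / (- (a / b))) powi n"
  proof -
    have "(- (a / b)) powi (m + 1 - n) = - (a / b) * (- (a / b)) powi (m - n)"
      using assms power_int_add[of "- (a / b)" 1 "m - n"] by (simp add: algebra_simps)
    moreover have "(- (a * b)) powi (m + n) * (- (a / b)) powi (m - n)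
      = ((- (a * b)) * (- (a / b))) powi m * ((- (a * b)) / (- (a / b))) powi n"
      using assms by (intro power_int_sum_difference) auto
    ultimately show ?thesis by (simp only: mult_ac)
  qed
  also have "\<dots> = - (a / b) * (a\<^sup>2) powi m * (b\<^sup>2) powi n"
    using assms by (simp add: power2_eq_square)
  finally have s: "(- (a * b)) powi (m + n) * (- (a / b)) powi (m + 1 - n)
      = - (a / b) * (a\<^sup>2) powi m * (b\<^sup>2) powi n" .
  have "b * (jtp_term p (a * b) (m + n) * jtp_term p (a / b) (m + 1 - n))
      = b * ((- (a * b)) powi (m + n) * (- (a / b)) powi (m + 1 - n)) * p powi (t (m + n) + t (m + 1 - n))"
    unfolding jtp_term_powi[OF assms(1)] t_def[symmetric]
    using assms(1) by (simp add: power_int_add)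
  also have "\<dots> = - a * ((b\<^sup>2) powi n * (p\<^sup>2) powi t n * ((p * a\<^sup>2) powi m * (p\<^sup>2) powi t m))"
    using assms unfolding e s
    by (simp add: power_int_add power_int_mult_distrib power_int_mult)
  finally show ?thesis
    using assms(1) by (simp add: jtp_term_powi t_def)
qed

text \<open>
  Multiplied by \<open>(p;p)\<^sub>\<infinity>\<^sup>2\<close>, the right-hand side is a double series over \<open>\<int> \<times> \<int>\<close>. The pairs with even
  coordinate sum contribute \<open>P(a) Q(b)\<close>, those with odd sum contribute \<open>- P(b) Q(a)\<close>.
  The triple product is used for nonzero nome; for \<open>p = 0\<close> the identity is
  \<open>(1 + a\<^sup>2) b - (1 + b\<^sup>2) a = b (1 - a b) (1 - a / b)\<close>.
\<close>

theorem AW_wronskian: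
  assumes p: "norm p < 1" and a: "a \<noteq> 0" and b: "b \<noteq> 0"
  shows "AW_P p a * AW_Q p b - AW_P p b * AW_Q p a = b * (mtheta (a * b) p * mtheta (a / b) p)"
proof (cases "p = 0")
  case True
  then show ?thesis using b
    by (simp add: AW_P_def AW_Q_def mtheta_nome_0 field_simps power2_eq_square qpoch_inf_zero)
next
  case False
  let ?G = "\<lambda>(k, l). b * (jtp_term p (a * b) k * jtp_term p (a / b) l)"
  let ?\<Phi> = "qpoch_inf p p" and ?\<Phi>2 = "qpoch_inf (p\<^sup>2) (p\<^sup>2)"
  let ?U = "\<lambda>c. mtheta (- (c\<^sup>2)) (p\<^sup>2)" and ?V = "\<lambda>c. mtheta (- (p * c\<^sup>2)) (p\<^sup>2)"
  have p2: "norm (p\<^sup>2) < 1" "p\<^sup>2 \<noteq> 0"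
    using p False by (auto simp: norm_power power_less_one_iff)
  have U: "(jtp_term (p\<^sup>2) (- (c\<^sup>2)) has_sum ?\<Phi>2 * ?U c) UNIV" if "c \<noteq> 0" for c
    using that by (intro jacobi_triple_product p2) auto
  have V: "(jtp_term (p\<^sup>2) (- (p * c\<^sup>2)) has_sum ?\<Phi>2 * ?V c) UNIV" if "c \<noteq> 0" for c
    using that False by (intro jacobi_triple_product p2) auto
  define E where "E = (\<lambda>(n :: int, m :: int). (n + m, n - m))"
  define O' where "O' = (\<lambda>(n :: int, m :: int). (m + n, m + 1 - n))"
  have inj: "inj E" "inj O'" by (auto simp: E_def O'_def inj_on_def)
  have E: "(?G has_sum ?\<Phi>2 * ?U a * (b * (?\<Phi>2 * ?V b))) (range E)"
  proof (subst has_sum_reindex[OF inj(1)])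
    have "?G \<circ> E = (\<lambda>(n, m). jtp_term (p\<^sup>2) (- (a\<^sup>2)) n * (b * jtp_term (p\<^sup>2) (- (p * b\<^sup>2)) m))"
      using jtp_term_product_even[OF False a b] by (auto simp: E_def fun_eq_iff)
    then show "(?G \<circ> E has_sum ?\<Phi>2 * ?U a * (b * (?\<Phi>2 * ?V b))) UNIV"
      using has_sum_complex_product[OF U[OF a] has_sum_cmult_right[OF V[OF b], of b]] by simp
  qed
  have O': "(?G has_sum - (?\<Phi>2 * ?U b * (a * (?\<Phi>2 * ?V a)))) (range O')"
  proof (subst has_sum_reindex[OF inj(2)])
    have "?G \<circ> O' = (\<lambda>z. - (case z of (n, m) \<Rightarrow>
        jtp_term (p\<^sup>2) (- (b\<^sup>2)) n * (a * jtp_term (p\<^sup>2) (- (p * a\<^sup>2)) m)))"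
      using jtp_term_product_odd[OF False a b] by (auto simp: O'_def fun_eq_iff)
    then show "(?G \<circ> O' has_sum - (?\<Phi>2 * ?U b * (a * (?\<Phi>2 * ?V a)))) UNIV"
      using has_sum_complex_product[OF U[OF b] has_sum_cmult_right[OF V[OF a], of a]]
      by (simp add: has_sum_uminus)
  qed
  have "range E \<inter> range O' = {}"
  proof -
    have "even (fst (E z) + snd (E z))" "odd (fst (O' z) + snd (O' z))" for z
      by (auto simp: E_def O'_def split: prod.split)
    then show ?thesis by (auto simp: disjoint_iff) metis
  qed
  from has_sum_Un_disjoint[OF E O' this]
  have "(?G has_sum ?\<Phi>2 * ?U a * (b * (?\<Phi>2 * ?V b)) + - (?\<Phi>2 * ?U b * (a * (?\<Phi>2 * ?V a))))
          (range E \<union> range O')" .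
  also have "range E \<union> range O' = UNIV"
  proof -
    have "(k, l) \<in> range E \<union> range O'" for k l :: int
    proof (cases "even (k + l)")
      case True
      then obtain s where "k + l = 2 * s" by blast
      then have "(k, l) = E (s, k - s)" by (simp add: E_def)
      then show ?thesis by blast
    next
      case False
      then obtain s where "k + l = 2 * s + 1" by (elim oddE)
      then have "(k, l) = O' (k - s, s)" by (simp add: O'_def)
      then show ?thesis by blast
    qed
    then show ?thesis by auto
  qed
  finally have sum1: "(?G has_sum ?\<Phi>2 * ?U a * (b * (?\<Phi>2 * ?V b)) + - (?\<Phi>2 * ?U b * (a * (?\<Phi>2 * ?V a)))) UNIV" .
  have "(jtp_term p (a * b) has_sum ?\<Phi> * mtheta (a * b) p) UNIV"
       "(jtp_term p (a / b) has_sum ?\<Phi> * mtheta (a / b) p) UNIV"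
    using a b by (auto intro!: jacobi_triple_product p False)
  from has_sum_cmult_right[OF has_sum_complex_product[OF this], of b]
  have sum2: "(?G has_sum b * (?\<Phi> * mtheta (a * b) p * (?\<Phi> * mtheta (a / b) p))) UNIV"
    by (simp add: case_prod_beta')
  have "?\<Phi>\<^sup>2 * (AW_P p a * AW_Q p b - AW_P p b * AW_Q p a)
      = ?\<Phi>2 * ?U a * (b * (?\<Phi>2 * ?V b)) + - (?\<Phi>2 * ?U b * (a * (?\<Phi>2 * ?V a)))"
    unfolding AW_P_def AW_Q_def qpoch_inf_double[OF p] by algebra
  also have "\<dots> = b * (?\<Phi> * mtheta (a * b) p * (?\<Phi> * mtheta (a / b) p))"
    using has_sum_unique[OF sum1 sum2] .
  also have "\<dots> = ?\<Phi>\<^sup>2 * (b * (mtheta (a * b) p * mtheta (a / b) p))" by algebra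
  finally show ?thesis using qpoch_inf_self_nonzero[OF p] by simp
qed

section \<open>Lagrange interpolation of binary forms\<close>

text \<open>
  Homogeneous polynomials of degree \<open>n\<close> in \<open>P\<close> and \<open>Q\<close>, generated as sums of products of linear
  forms. This presentation suits the interpolation formula, whose proof multiplies by one linear form
  at a time, and it contains both the monomials \<open>P^k Q^(M-k)\<close> and the theta factors.
\<close>

inductive binary_form :: "('a \<Rightarrow> 'b::field) \<Rightarrow> ('a \<Rightarrow> 'b) \<Rightarrow> nat \<Rightarrow> ('a \<Rightarrow> 'b) \<Rightarrow> bool"
  for P Q where
  const: "binary_form P Q 0 (\<lambda>_. c)"
| linear: "binary_form P Q n F \<Longrightarrow> binary_form P Q (Suc n) (\<lambda>u. (\<alpha> * P u + \<beta> * Q u) * F u)"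
| add: "binary_form P Q n F \<Longrightarrow> binary_form P Q n G \<Longrightarrow> binary_form P Q n (\<lambda>u. F u + G u)"

text \<open>
  Passing from \<open>F\<close> to \<open>L F\<close> with \<open>L\<close> linear adds one node \<open>v\<close>. Three vectors of a plane are linearly
  dependent, which gives \<open>L(u) W(v,a) = L(a) W(v,u) + L(v) W(u,a)\<close>. Apply this with \<open>a\<close> an old node to
  each term of the formula for \<open>F(u)\<close>: the first summand supplies the missing factor of the new
  Lagrange basis function at \<open>a\<close>, and the second summands add up, by the formula for \<open>F(v)\<close>,
  to \<open>L(v) F(v)\<close> times the basis function at \<open>v\<close>.
\<close>

lemma binary_form_interpolation:
  fixes P Q :: "'a \<Rightarrow> 'b::field"
  defines "W \<equiv> \<lambda>a b. P a * Q b - P b * Q a"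
  assumes "binary_form P Q n F"
    and "\<And>j k. j \<le> n \<Longrightarrow> k \<le> n \<Longrightarrow> j \<noteq> k \<Longrightarrow> W (w j) (w k) \<noteq> 0"
  shows "F u = (\<Sum>k\<le>n. F (w k) * (\<Prod>j\<in>{..n} - {k}. W (w j) u / W (w j) (w k)))"
  using assms(2,3)
proof (induction arbitrary: u rule: binary_form.induct)
  case (const c)
  then show ?case by simp
next
  case (add n F G)
  show ?case
    using add.IH(1)[OF add.prems, of u] add.IH(2)[OF add.prems, of u]
    by (simp add: distrib_right sum.distrib)
next
  case (linear n F \<alpha> \<beta>)
  define L where "L u = \<alpha> * P u + \<beta> * Q u" for u
  define v where "v = w (Suc n)"
  define R where "R k u = (\<Prod>j\<in>{..n} - {k}. W (w j) u / W (w j) (w k))" for k u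
  have IH: "F u = (\<Sum>k\<le>n. F (w k) * R k u)" for u
    unfolding R_def by (rule linear.IH) (use linear.prems in auto)
  have nz: "W v (w k) \<noteq> 0" "W (w k) v \<noteq> 0" if "k \<le> n" for k
    using linear.prems[of "Suc n" k] linear.prems[of k "Suc n"] that by (auto simp: v_def)
  have anti: "W a b = - W b a" for a b by (simp add: W_def)
  have pluecker: "L u * W v a = L a * W v u + L v * W u a" for u a
    unfolding W_def L_def by (simp add: algebra_simps)
  define Z where "Z u = (\<Prod>j\<le>n. W (w j) u)" for u
  have Zv: "Z v \<noteq> 0" unfolding Z_def using nz(2) by simp
  have last: "L v * F v * (Z u / Z v) = (\<Sum>k\<le>n. F (w k) * (L v * W u (w k) / W v (w k) * R k u))"
  proof -
    have "F (w k) * (L v * W u (w k) / W v (w k) * R k u) = L v * (Z u / Z v) * (F (w k) * R k v)"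
      if k: "k \<le> n" for k
    proof -
      have Z: "Z u = W (w k) u * (\<Prod>j\<in>{..n} - {k}. W (w j) u)" for u
        unfolding Z_def using k by (intro prod.remove) auto
      have "R k v * (Z u / Z v) = (W (w k) u / W (w k) v) * R k u"
        using Zv unfolding R_def prod_dividef Z[of u] Z[of v] by (simp add: field_simps)
      also have "W (w k) u / W (w k) v = W u (w k) / W v (w k)"
        using anti[of "w k" u] anti[of "w k" v] by simp
      finally have e: "R k v * (Z u / Z v) = W u (w k) / W v (w k) * R k u" .
      have "L v * (Z u / Z v) * (F (w k) * R k v) = L v * F (w k) * (R k v * (Z u / Z v))"
        by (simp only: mult_ac)
      then show ?thesis unfolding e by (simp add: mult_ac)
    qed
    then have "(\<Sum>k\<le>n. F (w k) * (L v * W u (w k) / W v (w k) * R k u))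
      = (\<Sum>k\<le>n. L v * (Z u / Z v) * (F (w k) * R k v))" by (intro sum.cong) auto
    also have "\<dots> = L v * (Z u / Z v) * F v"
      by (subst IH[of v]) (simp add: sum_distrib_left)
    finally show ?thesis by (simp add: mult_ac)
  qed
  have "L u * F u = (\<Sum>k\<le>n. F (w k) * (L u * R k u))"
    by (subst IH[of u]) (simp add: sum_distrib_left mult_ac)
  also have "\<dots> = (\<Sum>k\<le>n. L (w k) * F (w k) * (W v u / W v (w k) * R k u)
        + F (w k) * (L v * W u (w k) / W v (w k) * R k u))"
  proof (intro sum.cong refl)
    fix k assume "k \<in> {..n}"
    then have "L u = (L (w k) * W v u + L v * W u (w k)) / W v (w k)"
      using pluecker[of u "w k"] nz(1)[of k] by (simp add: field_simps)
    then show "F (w k) * (L u * R k u) = L (w k) * F (w k) * (W v u / W v (w k) * R k u)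
        + F (w k) * (L v * W u (w k) / W v (w k) * R k u)"
      by (simp add: add_divide_distrib algebra_simps)
  qed
  also have "\<dots> = (\<Sum>k\<le>n. L (w k) * F (w k) * (W v u / W v (w k) * R k u)) + L v * F v * (Z u / Z v)"
    unfolding sum.distrib last ..
  also have "\<dots> = (\<Sum>k\<le>Suc n. L (w k) * F (w k) * (\<Prod>j\<in>{..Suc n} - {k}. W (w j) u / W (w j) (w k)))"
  proof -
    have "(\<Prod>j\<in>{..Suc n} - {k}. W (w j) u / W (w j) (w k)) = W v u / W v (w k) * R k u" if "k \<le> n" for k
    proof -
      have "{..Suc n} - {k} = insert (Suc n) ({..n} - {k})" using that by auto
      then show ?thesis by (simp add: R_def v_def)
    qed
    then have "(\<Sum>k\<le>n. L (w k) * F (w k) * (W v u / W v (w k) * R k u))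
      = (\<Sum>k\<le>n. L (w k) * F (w k) * (\<Prod>j\<in>{..Suc n} - {k}. W (w j) u / W (w j) (w k)))"
      by (intro sum.cong refl) (simp only: atMost_iff)
    moreover have "Z u / Z v = (\<Prod>j\<in>{..Suc n} - {Suc n}. W (w j) u / W (w j) (w (Suc n)))"
    proof -
      have "{..Suc n} - {Suc n} = {..n}" by auto
      then show ?thesis by (simp only: Z_def v_def prod_dividef)
    qed
    ultimately show ?thesis by (simp only: sum.atMost_Suc v_def)
  qed
  finally show ?case by (simp add: L_def)
qed

lemma binary_form_sum:
  assumes "finite I" "I \<noteq> {}" "\<And>i. i \<in> I \<Longrightarrow> binary_form P Q n (F i)"
  shows "binary_form P Q n (\<lambda>u. \<Sum>i\<in>I. F i u)"
  using assms by (induction I rule: finite_ne_induct) (auto intro: binary_form.add)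

lemma binary_form_prod_linear:
  assumes "finite I" "binary_form P Q n F"
  shows "binary_form P Q (card I + n) (\<lambda>u. (\<Prod>i\<in>I. \<alpha> i * P u + \<beta> i * Q u) * F u)"
  using assms
proof (induction I rule: finite_induct)
  case (insert i I)
  then show ?case
    using binary_form.linear[of P Q "card I + n" _ "\<alpha> i" "\<beta> i"] by (simp add: mult.assoc)
qed simp

lemma binary_form_AW:
  "binary_form P Q M (\<lambda>u. \<Sum>k=0..M. c k * P u ^ k * Q u ^ (M - k))"
proof (rule binary_form_sum)
  fix k assume k: "k \<in> {0..M}"
  have "binary_form P Q (card {..<k} + (card {..<M - k} + 0))
     (\<lambda>u. (\<Prod>i<k. 1 * P u + 0 * Q u) * ((\<Prod>i<M - k. 0 * P u + 1 * Q u) * c k))"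
    by (intro binary_form_prod_linear binary_form.const) auto
  then show "binary_form P Q M (\<lambda>u. c k * P u ^ k * Q u ^ (M - k))"
    using k by (simp add: mult_ac)
qed auto

section \<open>The expansion for generic parameters\<close>

text \<open>
  Both sides multiply \<open>g\<close> over the same multiset of indices. With \<open>g j = \<theta>(y q\<^sup>j)\<close> this reads
  \<open>(yq)\<^sub>k \<Prod>\<theta>(y q\<^sup>j) = (y)\<^sub>k (yq)\<^sub>N\<close> with the product over \<open>j \<noteq> k\<close>, which
  converts the numerators of the Lagrange basis.
\<close>

lemma prod_omit_index:
  fixes g :: "nat \<Rightarrow> 'a::comm_monoid_mult"
  assumes "k \<le> N"
  shows "(\<Prod>j\<in>{..N} - {k}. g j) * (\<Prod>j<k. g (Suc j)) = (\<Prod>j<k. g j) * (\<Prod>j<N. g (Suc j))"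
proof -
  have set: "{..N} - {k} = {..<k} \<union> {Suc k..N}" using assms by auto
  have "(\<Prod>j<N. g (Suc j)) = (\<Prod>j\<in>{1..N}. g j)"
    by (rule prod.reindex_bij_witness[where i = "\<lambda>j. j - 1" and j = Suc]) auto
  also have "{1..N} = {1..k} \<union> {Suc k..N}" using assms by auto
  also have "(\<Prod>j\<in>\<dots>. g j) = (\<Prod>j\<in>{1..k}. g j) * (\<Prod>j\<in>{Suc k..N}. g j)"
    by (rule prod.union_disjoint) auto
  also have "(\<Prod>j\<in>{1..k}. g j) = (\<Prod>j<k. g (Suc j))"
    by (rule prod.reindex_bij_witness[where i = Suc and j = "\<lambda>j. j - 1"]) auto
  finally show ?thesis
    unfolding set by (subst prod.union_disjoint) (auto simp: mult_ac)
qed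

text \<open>
  With \<open>g j = \<theta>(C\<^sup>2 q\<^sup>j)\<close> both sides are the shifted factorial of \<open>C\<^sup>2\<close> of length \<open>N + k + 1\<close>;
  the omitted index \<open>j = k\<close> produces the very-well-poised factor \<open>\<theta>(C\<^sup>2 q^(2k))\<close>.
\<close>

lemma prod_omit_shifted_index:
  fixes g :: "nat \<Rightarrow> 'a::comm_monoid_mult"
  assumes "k \<le> N"
  shows "(\<Prod>j\<in>{..N} - {k}. g (j + k)) * (g (2 * k) * (\<Prod>j<k. g j))
       = g 0 * (\<Prod>j<N. g (Suc j)) * (\<Prod>j<k. g (Suc N + j))"
proof -
  have split: "(\<Prod>j<a + b. g j) = (\<Prod>j<a. g j) * (\<Prod>j<b. g (a + j))" for a b
    by (induction b) (simp_all add: mult_ac)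
  have "(\<Prod>j\<in>{..N} - {k}. g (j + k)) * g (2 * k) = (\<Prod>j\<le>N. g (j + k))"
    using prod.remove[OF finite_atMost, of k N "\<lambda>j. g (j + k)"] assms
    unfolding mult_2 by (simp add: mult.commute)
  also have "\<dots> = (\<Prod>j<Suc N. g (k + j))" by (simp only: lessThan_Suc_atMost add.commute)
  finally have "(\<Prod>j\<in>{..N} - {k}. g (j + k)) * (g (2 * k) * (\<Prod>j<k. g j)) = (\<Prod>j<k + Suc N. g j)"
    unfolding split by (simp only: mult_ac)
  also have "k + Suc N = Suc N + k" by simp
  also have "(\<Prod>j<Suc N + k. g j) = g 0 * (\<Prod>j<N. g (Suc j)) * (\<Prod>j<k. g (Suc N + j))"
    unfolding split by (simp only: prod.lessThan_Suc_shift o_def)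
  finally show ?thesis .
qed

text \<open>
  Negative powers of \<open>q\<close> occur in \<open>k\<close> factors \<open>\<theta>(1/q^(j+1))\<close> of the product, one for each \<open>j < k\<close>, and
  in the \<open>k\<close> factors \<open>\<theta>(1/q^(N-j))\<close> of \<open>(1/q^N;q,p)\<^sub>k\<close>. Reflecting them yields the prefactors
  \<open>- 1/q^(j+1)\<close> and \<open>- 1/q^(N-j)\<close>, whose product \<open>1/q^(N+1)\<close> does not depend on \<open>j\<close>.
\<close>

lemma mtheta_power_quotients:
  assumes p: "norm p < 1" and q: "q \<noteq> 0" and k: "k \<le> N"
  shows "q ^ (k * (N + 1)) * theta_fact (q powi (- int N)) q p k
          * (\<Prod>j\<in>{..N} - {k}. mtheta (q ^ j / q ^ k) p)
       = theta_fact q q p k * theta_fact q q p N"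
proof -
  define h where "h i = mtheta (q ^ i) p" for i
  have inv: "mtheta (1 / q ^ i) p = - h i / q ^ i" for i
    unfolding h_def using q by (intro mtheta_inverse p) auto
  have set: "{..N} - {k} = {..<k} \<union> {Suc k..N}" using k by auto
  have "(\<Prod>j<k. mtheta (q ^ j / q ^ k) p) = (\<Prod>j<k. mtheta (1 / q ^ (k - j)) p)"
    using q by (intro prod.cong arg_cong2[where f = mtheta] refl) (auto simp: power_diff field_simps)
  also have "\<dots> = (\<Prod>j<k. - h (Suc j) / q ^ Suc j)"
    unfolding inv by (rule prod.reindex_bij_witness[where i = "\<lambda>j. k - Suc j" and j = "\<lambda>j. k - Suc j"])
       (auto simp: Suc_diff_Suc)
  finally have low: "(\<Prod>j<k. mtheta (q ^ j / q ^ k) p) = (\<Prod>j<k. - h (Suc j) / q ^ Suc j)" .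
  have high: "(\<Prod>j\<in>{Suc k..N}. mtheta (q ^ j / q ^ k) p) = (\<Prod>j<N - k. h (Suc j))"
    unfolding h_def
    by (rule prod.reindex_bij_witness[where i = "\<lambda>j. Suc j + k" and j = "\<lambda>j. j - Suc k"])
       (use q in \<open>auto simp: power_diff[symmetric] Suc_diff_Suc\<close>)
  have neg: "theta_fact (q powi (- int N)) q p k = (\<Prod>j<k. - h (N - j) / q ^ (N - j))"
    unfolding theta_fact_def inv[symmetric]
    using q k by (intro prod.cong arg_cong2[where f = mtheta] refl)
      (auto simp: power_diff power_int_minus field_simps)
  have "q ^ (k * (N + 1)) = (\<Prod>j<k. q ^ (N + 1))"
    by (simp only: prod_constant card_lessThan mult.commute[of k] power_mult)
  then have "q ^ (k * (N + 1)) * theta_fact (q powi (- int N)) q p k * (\<Prod>j<k. mtheta (q ^ j / q ^ k) p)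
     = (\<Prod>j<k. q ^ (N + 1) * (- h (N - j) / q ^ (N - j)) * (- h (Suc j) / q ^ Suc j))"
    unfolding low neg by (simp only: prod.distrib)
  also have "\<dots> = (\<Prod>j<k. h (N - j) * h (Suc j))"
  proof (rule prod.cong)
    fix j assume "j \<in> {..<k}"
    then have "N + 1 = (N - j) + Suc j" using k by auto
    then have "q ^ (N + 1) = q ^ (N - j) * q ^ Suc j" by (metis power_add)
    then show "q ^ (N + 1) * (- h (N - j) / q ^ (N - j)) * (- h (Suc j) / q ^ Suc j) = h (N - j) * h (Suc j)"
      using q by simp
  qed simp
  also have "\<dots> = (\<Prod>j<k. h (N - j)) * (\<Prod>j<k. h (Suc j))" by (rule prod.distrib)
  finally have 1: "q ^ (k * (N + 1)) * theta_fact (q powi (- int N)) q p k * (\<Prod>j<k. mtheta (q ^ j / q ^ k) p)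
     = (\<Prod>j<k. h (N - j)) * (\<Prod>j<k. h (Suc j))" .
  have "(\<Prod>j<N. h (Suc j)) = (\<Prod>j<N. h (N - j))"
    by (rule prod.reindex_bij_witness[where i = "\<lambda>j. N - Suc j" and j = "\<lambda>j. N - Suc j"])
       (auto simp: Suc_diff_Suc)
  also have "\<dots> = (\<Prod>j\<in>{..<k} \<union> {k..<N}. h (N - j))" using k by (intro prod.cong) auto
  also have "\<dots> = (\<Prod>j<k. h (N - j)) * (\<Prod>j\<in>{k..<N}. h (N - j))"
    by (rule prod.union_disjoint) auto
  also have "(\<Prod>j\<in>{k..<N}. h (N - j)) = (\<Prod>j<N - k. h (Suc j))"
    by (rule prod.reindex_bij_witness[where i = "\<lambda>j. N - Suc j" and j = "\<lambda>j. N - Suc j"])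
       (auto simp: Suc_diff_Suc)
  finally have 2: "(\<Prod>j<N. h (Suc j)) = (\<Prod>j<k. h (N - j)) * (\<Prod>j<N - k. h (Suc j))" .
  have "(\<Prod>j\<in>{..N} - {k}. mtheta (q ^ j / q ^ k) p)
      = (\<Prod>j<k. mtheta (q ^ j / q ^ k) p) * (\<Prod>j<N - k. h (Suc j))"
    unfolding set high[symmetric] by (rule prod.union_disjoint) auto
  then have "q ^ (k * (N + 1)) * theta_fact (q powi (- int N)) q p k
          * (\<Prod>j\<in>{..N} - {k}. mtheta (q ^ j / q ^ k) p)
      = (\<Prod>j<k. h (Suc j)) * (\<Prod>j<N. h (Suc j))"
    using 1 2 by (simp add: mult_ac)
  then show ?thesis by (simp add: theta_fact_def h_def)
qed

lemma theta_fact_mono_nonzero: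
  assumes "theta_fact y q p n \<noteq> 0" "k \<le> n"
  shows "theta_fact y q p k \<noteq> 0"
  using assms by (auto simp: theta_fact_def)

text \<open>
  Here the nodes \<open>C q\<^sup>k\<close> are pairwise non-proportional, because
  \<open>W(C q\<^sup>j, C q\<^sup>k)\<close> is a nonzero multiple of \<open>\<theta>(C\<^sup>2 q^(j+k)) \<theta>(q^(j-k))\<close>. The three product formulas
  above turn the Lagrange basis functions into the coefficients of the expansion.
\<close>

lemma theta_expansion_generic:
  fixes p q C x :: complex and A :: "nat \<Rightarrow> complex" and m N\<^sub>0 :: nat
  assumes p: "norm p < 1" and q: "q \<noteq> 0" and C: "C \<noteq> 0" and x: "x \<noteq> 0"
    and A: "\<And>i. i \<in> {1..m} \<Longrightarrow> A i \<noteq> 0"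
    and Cx: "theta_fact (C * x * q) q p (m + N\<^sub>0) \<noteq> 0" "theta_fact (C * q / x) q p (m + N\<^sub>0) \<noteq> 0"
    and qn: "theta_fact q q p (m + N\<^sub>0) \<noteq> 0"
    and generic: "\<And>s. s \<le> 2 * (m + N\<^sub>0) \<Longrightarrow> mtheta (C\<^sup>2 * q ^ s) p \<noteq> 0"
    and f: "f \<in> AW_space p N\<^sub>0"
  shows "(C / x) ^ N\<^sub>0
      * (theta_facts [q, C\<^sup>2 * q] q p (m + N\<^sub>0)
          / theta_facts [C * x * q, C * q / x] q p (m + N\<^sub>0))
      * f x * (\<Prod>i=1..m. mthetas [A i * x, A i / x] p)
    = (\<Sum>k=0..m + N\<^sub>0. q ^ (k * (m + 1))
      * (mtheta (C\<^sup>2 * q ^ (2 * k)) p / mtheta (C\<^sup>2) p)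
      * (theta_facts [C\<^sup>2, C / x, C * x, q powi (- int (m + N\<^sub>0))] q p k
          / theta_facts [q, C * x * q, C * q / x, C\<^sup>2 * q ^ (m + N\<^sub>0 + 1)] q p k)
      * f (C * q ^ k)
      * (\<Prod>i=1..m. mthetas [A i * C * q ^ k, A i * q powi (- int k) / C] p))"
proof -
  define N where "N = m + N\<^sub>0"
  obtain c where c: "\<And>u. u \<noteq> 0 \<Longrightarrow> f u = (\<Sum>k=0..N\<^sub>0. c k * AW_P p u ^ k * AW_Q p u ^ (N\<^sub>0 - k))"
    using f by (auto simp: AW_space_def)
  define g where "g u = (\<Sum>k=0..N\<^sub>0. c k * AW_P p u ^ k * AW_Q p u ^ (N\<^sub>0 - k))" for u
  \<comment> \<open>The \<open>i\<close>-th linear factor is \<open>W (A i) u = u * \<theta>(A i * u) * \<theta>(A i / u)\<close>; this is why \<open>F\<close> carries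
    the power \<open>u ^ m\<close>.\<close>
  define F where "F u = (\<Prod>i=1..m. - AW_Q p (A i) * AW_P p u + AW_P p (A i) * AW_Q p u) * g u" for u
  define \<Theta> where "\<Theta> u = (\<Prod>i=1..m. mthetas [A i * u, A i / u] p)" for u
  define w where "w k = C * q ^ k" for k
  define W where "W a b = AW_P p a * AW_Q p b - AW_P p b * AW_Q p a" for a b
  have w0: "w k \<noteq> 0" for k using C q by (simp add: w_def)
  have W: "W a b = b * (mtheta (a * b) p * mtheta (a / b) p)" if "a \<noteq> 0" "b \<noteq> 0" for a b
    unfolding W_def using AW_wronskian[OF p that] .
  have F_eq: "F u = u ^ m * f u * \<Theta> u" if u: "u \<noteq> 0" for u
  proof -
    have "(\<Prod>i=1..m. - AW_Q p (A i) * AW_P p u + AW_P p (A i) * AW_Q p u)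
        = (\<Prod>i=1..m. u * mthetas [A i * u, A i / u] p)"
    proof (rule prod.cong)
      fix i assume "i \<in> {1..m}"
      from W[OF A[OF this] u] show "- AW_Q p (A i) * AW_P p u + AW_P p (A i) * AW_Q p u
          = u * mthetas [A i * u, A i / u] p"
        by (simp add: W_def mthetas_def mult_ac)
    qed simp
    also have "\<dots> = u ^ m * \<Theta> u" by (simp add: prod.distrib \<Theta>_def)
    finally show ?thesis using c[OF u] by (simp add: F_def g_def mult_ac)
  qed
  have form: "binary_form (AW_P p) (AW_Q p) N F"
  proof -
    have "binary_form (AW_P p) (AW_Q p) (card {1..m} + N\<^sub>0) F"
      unfolding F_def g_def
      by (rule binary_form_prod_linear[where \<alpha> = "\<lambda>i. - AW_Q p (A i)" and \<beta> = "\<lambda>i. AW_P p (A i)",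
            OF finite_atLeastAtMost binary_form_AW])
    then show ?thesis by (simp add: N_def)
  qed
  have q_diff: "mtheta (q ^ j / q ^ k) p \<noteq> 0" if jk: "j \<le> N" "k \<le> N" "j \<noteq> k" for j k
  proof -
    have h: "mtheta (q ^ i) p \<noteq> 0" if "0 < i" "i \<le> N" for i
    proof -
      have "i - 1 < N" using that by auto
      then have "mtheta (q * q ^ (i - 1)) p \<noteq> 0" using qn by (auto simp: theta_fact_def N_def)
      then show ?thesis using that by (cases i) auto
    qed
    show ?thesis
    proof (cases "j < k")
      case True
      then have "q ^ j / q ^ k = 1 / q ^ (k - j)" using q by (simp add: power_diff)
      then show ?thesis using mtheta_inverse[OF p, of "q ^ (k - j)"] h[of "k - j"] True jk q by simp
    next
      case False
      then have "q ^ j / q ^ k = q ^ (j - k)" using q by (simp add: power_diff)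
      then show ?thesis using h[of "j - k"] False jk by simp
    qed
  qed
  have ww: "w j * w k = C\<^sup>2 * q ^ (j + k)" "w j / w k = q ^ j / q ^ k" for j k
    using C by (simp_all add: w_def power2_eq_square power_add)
  have distinct: "W (w j) (w k) \<noteq> 0" if "j \<le> N" "k \<le> N" "j \<noteq> k" for j k
    unfolding W[OF w0 w0] ww using w0 generic[of "j + k"] q_diff[OF that] that
    by (simp add: N_def)
  define T where "T y k = theta_fact y q p k" for y k
  have interp: "F x = (\<Sum>k\<le>N. F (w k) * (\<Prod>j\<in>{..N} - {k}. W (w j) x / W (w j) (w k)))"
    unfolding W_def by (rule binary_form_interpolation[OF form]) (use distinct in \<open>simp add: W_def\<close>)
  have coeff: "(C / x) ^ N\<^sub>0 * (T q N * T (C\<^sup>2 * q) N / (T (C * x * q) N * T (C * q / x) N))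
       * (w k ^ m / x ^ m * (\<Prod>j\<in>{..N} - {k}. W (w j) x / W (w j) (w k)))
     = q ^ (k * (m + 1)) * (mtheta (C\<^sup>2 * q ^ (2 * k)) p / mtheta (C\<^sup>2) p)
       * (T (C\<^sup>2) k * T (C / x) k * T (C * x) k * T (q powi (- int N)) k
         / (T q k * T (C * x * q) k * T (C * q / x) k * T (C\<^sup>2 * q ^ (N + 1)) k))"
    if k: "k \<le> N" for k
  proof -
    define B where "B y = (\<Prod>j\<in>{..N} - {k}. mtheta (y j) p)" for y :: "nat \<Rightarrow> complex"
    have B: "B (\<lambda>j. y * q ^ j) * T (y * q) k = T y k * T (y * q) N" for y
      using prod_omit_index[OF k, of "\<lambda>j. mtheta (y * q ^ j) p"]
      by (simp add: B_def T_def theta_fact_def mult_ac)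
    have B1: "B (\<lambda>j. C * x * q ^ j) = T (C * x) k * T (C * x * q) N / T (C * x * q) k"
      using B[of "C * x"] theta_fact_mono_nonzero[OF Cx(1), of k] k by (simp add: T_def N_def field_simps)
    have B2: "B (\<lambda>j. C / x * q ^ j) = T (C / x) k * T (C * q / x) N / T (C * q / x) k"
      using B[of "C / x"] theta_fact_mono_nonzero[OF Cx(2), of k] k by (simp add: T_def N_def field_simps)
    have gen: "mtheta (C\<^sup>2 * q ^ (2 * k)) p \<noteq> 0" "mtheta (C\<^sup>2) p \<noteq> 0" "T (C\<^sup>2) k \<noteq> 0"
       "T (C\<^sup>2 * q) N \<noteq> 0" "T (C\<^sup>2 * q ^ (N + 1)) k \<noteq> 0"
    proof -
      show "mtheta (C\<^sup>2 * q ^ (2 * k)) p \<noteq> 0" using generic[of "2 * k"] k by (simp add: N_def)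
      show "mtheta (C\<^sup>2) p \<noteq> 0" using generic[of 0] by simp
      show "T (C\<^sup>2) k \<noteq> 0" using generic k by (auto simp: T_def theta_fact_def N_def)
      have "mtheta (C\<^sup>2 * q * q ^ j) p \<noteq> 0" if "j < N" for j
        using generic[of "Suc j"] that by (simp add: N_def mult_ac)
      then show "T (C\<^sup>2 * q) N \<noteq> 0" by (simp add: T_def theta_fact_def)
      have "mtheta (C\<^sup>2 * q ^ (N + 1) * q ^ j) p \<noteq> 0" if "j < k" for j
        using generic[of "N + 1 + j"] that k by (simp add: N_def mult_ac power_add)
      then show "T (C\<^sup>2 * q ^ (N + 1)) k \<noteq> 0" by (simp add: T_def theta_fact_def)
    qed
    have B3: "B (\<lambda>j. C\<^sup>2 * q ^ (j + k)) * (mtheta (C\<^sup>2 * q ^ (2 * k)) p * T (C\<^sup>2) k)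
       = mtheta (C\<^sup>2) p * T (C\<^sup>2 * q) N * T (C\<^sup>2 * q ^ (N + 1)) k"
      using prod_omit_shifted_index[OF k, of "\<lambda>j. mtheta (C\<^sup>2 * q ^ j) p"]
      by (simp add: B_def T_def theta_fact_def mult_ac power_add)
    then have B3: "B (\<lambda>j. C\<^sup>2 * q ^ (j + k))
       = mtheta (C\<^sup>2) p * T (C\<^sup>2 * q) N * T (C\<^sup>2 * q ^ (N + 1)) k / (mtheta (C\<^sup>2 * q ^ (2 * k)) p * T (C\<^sup>2) k)"
      using gen by (simp add: field_simps)
    have qk: "T q k \<noteq> 0" "T q N \<noteq> 0"
      using theta_fact_mono_nonzero[OF qn, of k] qn k by (auto simp: T_def N_def)
    have B4: "q ^ (k * (N + 1)) * T (q powi (- int N)) k * B (\<lambda>j. q ^ j / q ^ k) = T q k * T q N"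
      using mtheta_power_quotients[OF p q k] by (simp add: B_def T_def)
    then have nz: "T (q powi (- int N)) k \<noteq> 0" using qk by auto
    have B4: "B (\<lambda>j. q ^ j / q ^ k) = T q k * T q N / (q ^ (k * (N + 1)) * T (q powi (- int N)) k)"
      using B4 nz q by (simp add: field_simps)
    have card: "card ({..N} - {k}) = N" using k by simp
    have "(\<Prod>j\<in>{..N} - {k}. W (w j) x / W (w j) (w k))
      = (\<Prod>j\<in>{..N} - {k}. x / w k * (mtheta (C * x * q ^ j) p * mtheta (C / x * q ^ j) p
           / (mtheta (C\<^sup>2 * q ^ (j + k)) p * mtheta (q ^ j / q ^ k) p)))"
    proof (rule prod.cong)
      fix j
      have wx: "w j * x = C * x * q ^ j" "w j / x = C / x * q ^ j" by (simp_all add: w_def)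
      show "W (w j) x / W (w j) (w k) = x / w k * (mtheta (C * x * q ^ j) p * mtheta (C / x * q ^ j) p
           / (mtheta (C\<^sup>2 * q ^ (j + k)) p * mtheta (q ^ j / q ^ k) p))"
        unfolding W[OF w0 w0] W[OF w0 x] ww wx by simp
    qed simp
    also have "\<dots> = (x / w k) ^ N * (B (\<lambda>j. C * x * q ^ j) * B (\<lambda>j. C / x * q ^ j)
        / (B (\<lambda>j. C\<^sup>2 * q ^ (j + k)) * B (\<lambda>j. q ^ j / q ^ k)))"
      unfolding prod.distrib prod_dividef B_def by (simp add: card power_divide)
    finally have prod: "(\<Prod>j\<in>{..N} - {k}. W (w j) x / W (w j) (w k)) = \<dots>" .
    \<comment> \<open>The degree \<open>N\<close> supplies \<open>(x / w k) ^ N\<close>, of which \<open>m\<close> factors are absorbed by the powers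
    \<open>u ^ m\<close> in \<open>F\<close>; the remaining \<open>N\<^sub>0\<close> factors cancel \<open>(C / x) ^ N\<^sub>0\<close> up to a power of \<open>q\<close>.\<close>
    have pow: "(C / x) ^ N\<^sub>0 * (w k ^ m / x ^ m * (x / w k) ^ N) * q ^ (k * (N + 1)) = q ^ (k * (m + 1))"
    proof -
      have "w k ^ m / x ^ m * (x / w k) ^ N = (x / w k) ^ N\<^sub>0"
        using w0 x by (simp add: N_def power_add power_divide)
      moreover have "(C / x) * (x / w k) = 1 / q ^ k" using C x by (simp add: w_def)
      then have "(C / x) ^ N\<^sub>0 * (x / w k) ^ N\<^sub>0 = 1 / q ^ (k * N\<^sub>0)"
        by (metis power_mult power_mult_distrib power_one_over)
      moreover have "k * (N + 1) = k * N\<^sub>0 + k * (m + 1)" by (simp add: N_def algebra_simps)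
      ultimately show ?thesis using q by (simp add: power_add)
    qed
    have cxN: "T (C * x * q) N \<noteq> 0" "T (C * q / x) N \<noteq> 0" using Cx by (auto simp: T_def N_def)
    show ?thesis
      unfolding prod B1 B2 B3 B4 pow[symmetric]
      using gen qk nz cxN q by (simp add: divide_simps)
  qed
  have \<Theta>_w: "\<Theta> (w k) = (\<Prod>i=1..m. mthetas [A i * C * q ^ k, A i * q powi (- int k) / C] p)" for k
  proof -
    have "A i / w k = A i * q powi (- int k) / C" for i
      by (simp add: w_def power_int_minus field_simps)
    then show ?thesis by (simp add: \<Theta>_def w_def mult.assoc)
  qed
  define K where "K = (C / x) ^ N\<^sub>0 * (T q N * T (C\<^sup>2 * q) N / (T (C * x * q) N * T (C * q / x) N))"
  have "K * f x * \<Theta> x = K / x ^ m * F x"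
    using F_eq[OF x] x by simp
  also have "\<dots> = (\<Sum>k\<le>N. K * (w k ^ m / x ^ m * (\<Prod>j\<in>{..N} - {k}. W (w j) x / W (w j) (w k))) * f (w k) * \<Theta> (w k))"
    unfolding interp sum_distrib_left by (intro sum.cong refl) (simp add: F_eq[OF w0] mult_ac)
  also have "\<dots> = (\<Sum>k\<le>N. q ^ (k * (m + 1)) * (mtheta (C\<^sup>2 * q ^ (2 * k)) p / mtheta (C\<^sup>2) p)
       * (T (C\<^sup>2) k * T (C / x) k * T (C * x) k * T (q powi (- int N)) k
         / (T q k * T (C * x * q) k * T (C * q / x) k * T (C\<^sup>2 * q ^ (N + 1)) k)) * f (w k) * \<Theta> (w k))"
    unfolding K_def by (intro sum.cong refl) (simp only: coeff atMost_iff)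
  finally show ?thesis
    unfolding \<Theta>_w unfolding K_def \<Theta>_def N_def[symmetric] atLeast0AtMost
    by (simp add: theta_facts_def T_def w_def mult.assoc)
qed

section \<open>Passage to arbitrary parameters\<close>

lemma isCont_eventually_nonzero:
  fixes g :: "'a::t2_space \<Rightarrow> 'b::{t2_space, zero}"
  assumes "isCont g a" "g a \<noteq> 0"
  shows "\<forall>\<^sub>F c in nhds a. g c \<noteq> 0"
proof (rule tendsto_imp_eventually_ne)
  show "(g \<longlongrightarrow> g a) (nhds a)"
    using assms(1) unfolding isCont_def tendsto_at_iff_tendsto_nhds .
qed (rule assms)

lemma isCont_theta_fact:
  assumes "norm p < 1" "q \<noteq> 0" "isCont g c" "g c \<noteq> 0"
  shows "isCont (\<lambda>c. theta_fact (g c) q p n) c"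
  unfolding theta_fact_def
  by (intro continuous_intros isCont_mtheta assms) (use assms in auto)

text \<open>
  For \<open>p = 0\<close> the argument of the theta function in \<open>Q\<close> is \<open>0\<close>, where \<open>isCont_mtheta\<close> does not apply,
  but then \<open>Q(x) = x\<close>.
\<close>

lemma isCont_AW_space:
  assumes p: "norm p < 1" and f: "f \<in> AW_space p M" and y: "y \<noteq> 0"
  shows "isCont f y"
proof -
  obtain c where c: "\<And>u. u \<noteq> 0 \<Longrightarrow> f u = (\<Sum>k=0..M. c k * AW_P p u ^ k * AW_Q p u ^ (M - k))"
    using f by (auto simp: AW_space_def)
  have p2: "norm (p\<^sup>2) < 1"
    using p by (simp add: norm_power power_less_one_iff)
  have P: "isCont (AW_P p) y"
    unfolding AW_P_def[abs_def] using y by (intro continuous_intros isCont_mtheta p2) auto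
  have Q: "isCont (AW_Q p) y"
  proof (cases "p = 0")
    case True
    then show ?thesis by (simp add: AW_Q_def[abs_def] mtheta_nome_0)
  next
    case False
    then show ?thesis
      unfolding AW_Q_def[abs_def] using y by (intro continuous_intros isCont_mtheta p2) auto
  qed
  have "isCont (\<lambda>u. \<Sum>k=0..M. c k * AW_P p u ^ k * AW_Q p u ^ (M - k)) y"
    by (intro continuous_intros P Q)
  moreover have "\<forall>\<^sub>F u in nhds y. f u = (\<Sum>k=0..M. c k * AW_P p u ^ k * AW_Q p u ^ (M - k))"
    using t1_space_nhds[OF y] by eventually_elim (rule c)
  ultimately show ?thesis by (simp add: isCont_cong)
qed

text \<open>
  Each \<open>s\<close> and each zero \<open>y\<close> of \<open>\<theta>\<close> leave at most two square roots of \<open>y/q\<^sup>s\<close>. For \<open>n = 2 N\<close> the set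
  contains every \<open>c \<noteq> 0\<close> for which two of the nodes \<open>c, c q, \<dots>, c q\<^sup>N\<close> are proportional, as long as
  none of \<open>q, \<dots>, q\<^sup>N\<close> is a zero of \<open>\<theta>\<close>.
\<close>

lemma countable_degenerate_parameters:
  assumes "norm p < 1" "q \<noteq> 0"
  shows "countable {c. \<exists>s\<le>n. mtheta (c\<^sup>2 * q ^ s) p = 0}"
proof (rule countable_subset)
  show "{c. \<exists>s\<le>n. mtheta (c\<^sup>2 * q ^ s) p = 0}
      \<subseteq> (\<Union>s\<in>{..n}. \<Union>y\<in>{y. mtheta y p = 0}. {c. c\<^sup>2 = y / q ^ s})"
  proof safe
    fix c s assume "s \<le> n" "mtheta (c\<^sup>2 * q ^ s) p = 0"
    moreover have "c\<^sup>2 = c\<^sup>2 * q ^ s / q ^ s" using assms(2) by simp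
    ultimately show "c \<in> (\<Union>s\<in>{..n}. \<Union>y\<in>{y. mtheta y p = 0}. {c. c\<^sup>2 = y / q ^ s})"
      by blast
  qed
  show "countable \<dots>"
    by (intro countable_UN countable_mtheta_zeros[OF assms(1)] countable_finite[OF finite_nth_roots]) auto
qed

text \<open>
  If the two sides differed at \<open>C\<close>, they would differ on a whole disc around \<open>C\<close>. A disc is
  uncountable, so it contains generic parameters, to which \<open>theta_expansion_generic\<close> applies.
\<close>

theorem theorem4p6:
  fixes p q C x :: complex and A :: "nat \<Rightarrow> complex" and m N\<^sub>0 :: nat
    and f :: "complex \<Rightarrow> complex"
  assumes "norm p < 1"
    and "q \<noteq> 0" and "C \<noteq> 0" and "x \<noteq> 0" and "\<And>i. i \<in> {1..m} \<Longrightarrow> A i \<noteq> 0"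
    and "theta_facts [C * x * q, C * q / x] q p (m + N\<^sub>0) \<noteq> 0"
    and "mtheta (C\<^sup>2) p \<noteq> 0"
    and "\<And>k. k \<le> m + N\<^sub>0 \<Longrightarrow>
      theta_facts [q, C * x * q, C * q / x, C\<^sup>2 * q ^ (m + N\<^sub>0 + 1)] q p k \<noteq> 0"
    and "f \<in> AW_space p N\<^sub>0"
  shows "(C / x) ^ N\<^sub>0
      * (theta_facts [q, C\<^sup>2 * q] q p (m + N\<^sub>0)
          / theta_facts [C * x * q, C * q / x] q p (m + N\<^sub>0))
      * f x * (\<Prod>i=1..m. mthetas [A i * x, A i / x] p)
    = (\<Sum>k=0..m + N\<^sub>0. q ^ (k * (m + 1))
      * (mtheta (C\<^sup>2 * q ^ (2 * k)) p / mtheta (C\<^sup>2) p)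
      * (theta_facts [C\<^sup>2, C / x, C * x, q powi (- int (m + N\<^sub>0))] q p k
          / theta_facts [q, C * x * q, C * q / x, C\<^sup>2 * q ^ (m + N\<^sub>0 + 1)] q p k)
      * f (C * q ^ k)
      * (\<Prod>i=1..m. mthetas [A i * C * q ^ k, A i * q powi (- int k) / C] p))"
proof -
  note p = assms(1) and q = assms(2) and C = assms(3) and x = assms(4) and A = assms(5)
    and f = assms(9)
  define lhs where "lhs c = (c / x) ^ N\<^sub>0
      * (theta_facts [q, c\<^sup>2 * q] q p (m + N\<^sub>0)
          / theta_facts [c * x * q, c * q / x] q p (m + N\<^sub>0))
      * f x * (\<Prod>i=1..m. mthetas [A i * x, A i / x] p)" for c
  define rhs where "rhs c = (\<Sum>k=0..m + N\<^sub>0. q ^ (k * (m + 1))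
      * (mtheta (c\<^sup>2 * q ^ (2 * k)) p / mtheta (c\<^sup>2) p)
      * (theta_facts [c\<^sup>2, c / x, c * x, q powi (- int (m + N\<^sub>0))] q p k
          / theta_facts [q, c * x * q, c * q / x, c\<^sup>2 * q ^ (m + N\<^sub>0 + 1)] q p k)
      * f (c * q ^ k)
      * (\<Prod>i=1..m. mthetas [A i * c * q ^ k, A i * q powi (- int k) / c] p))" for c
  define den where "den c = theta_facts [c * x * q, c * q / x] q p (m + N\<^sub>0)" for c
  have den_C: "den C \<noteq> 0" using assms(6) by (simp add: den_def)
  have qn: "theta_fact q q p (m + N\<^sub>0) \<noteq> 0"
    using assms(8)[of "m + N\<^sub>0"] by (auto simp: theta_facts_def)
  note nz = q C x
  have th: "isCont (\<lambda>c. theta_facts [g1 c, g2 c] q p k) C"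
    if "isCont g1 C" "isCont g2 C" "g1 C \<noteq> 0" "g2 C \<noteq> 0" for g1 g2 k
    unfolding theta_facts_def using that
    by (simp, intro continuous_intros isCont_theta_fact p q) auto
  have den: "isCont den C"
    unfolding den_def[abs_def] using nz by (intro th continuous_intros) auto
  have lhs: "isCont lhs C"
    unfolding lhs_def[abs_def] using nz assms(6) by (intro th continuous_intros) auto
  have rhs: "isCont rhs C"
    unfolding rhs_def[abs_def]
  proof (intro continuous_sum continuous_mult isCont_divide continuous_const continuous_prod)
    fix k assume k: "k \<in> {0..m + N\<^sub>0}"
    show "isCont (\<lambda>c. mtheta (c\<^sup>2 * q ^ (2 * k)) p) C" "isCont (\<lambda>c. mtheta (c\<^sup>2) p) C"
      using nz by (intro isCont_mtheta p continuous_intros; simp)+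
    show "mtheta (C\<^sup>2) p \<noteq> 0" by (rule assms(7))
    show "isCont (\<lambda>c. theta_facts [c\<^sup>2, c / x, c * x, q powi (- int (m + N\<^sub>0))] q p k) C"
      using nz by (simp add: theta_facts_def, intro continuous_intros isCont_theta_fact p q) auto
    show "isCont (\<lambda>c. theta_facts [q, c * x * q, c * q / x, c\<^sup>2 * q ^ (m + N\<^sub>0 + 1)] q p k) C"
      using nz by (simp add: theta_facts_def, intro continuous_intros isCont_theta_fact p q) auto
    show "theta_facts [q, C * x * q, C * q / x, C\<^sup>2 * q ^ (m + N\<^sub>0 + 1)] q p k \<noteq> 0"
      using k by (intro assms(8)) auto
    show "isCont (\<lambda>c. f (c * q ^ k)) C"
      using nz by (intro isCont_o2[OF _ isCont_AW_space[OF p f]] continuous_intros) auto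
    fix i assume i: "i \<in> {1..m}"
    show "isCont (\<lambda>c. mthetas [A i * c * q ^ k, A i * q powi (- int k) / c] p) C"
      using nz A[OF i] by (simp add: mthetas_def, intro continuous_intros isCont_mtheta p) auto
  qed
  have "lhs C = rhs C"
  proof (rule ccontr)
    assume "lhs C \<noteq> rhs C"
    then have "lhs C - rhs C \<noteq> 0" by simp
    moreover have "isCont (\<lambda>c. lhs c - rhs c) C" by (intro continuous_intros lhs rhs)
    ultimately have "\<forall>\<^sub>F c in nhds C. lhs c - rhs c \<noteq> 0"
      by (intro isCont_eventually_nonzero)
    moreover have "\<forall>\<^sub>F c in nhds C. den c \<noteq> 0"
      using den den_C by (rule isCont_eventually_nonzero)
    moreover have "\<forall>\<^sub>F c in nhds C. c \<noteq> 0" using C by (rule t1_space_nhds)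
    ultimately have "\<forall>\<^sub>F c in nhds C. lhs c - rhs c \<noteq> 0 \<and> den c \<noteq> 0 \<and> c \<noteq> 0"
      by eventually_elim simp
    then obtain r where r: "r > 0" "\<And>c. dist c C < r \<Longrightarrow> lhs c - rhs c \<noteq> 0 \<and> den c \<noteq> 0 \<and> c \<noteq> 0"
      unfolding eventually_nhds_metric by blast
    have "\<not> ball C r \<subseteq> {c. \<exists>s\<le>2 * (m + N\<^sub>0). mtheta (c\<^sup>2 * q ^ s) p = 0}"
      using countable_subset countable_degenerate_parameters[OF p q] uncountable_ball[OF r(1)] by blast
    then obtain c where c: "dist c C < r" "\<And>s. s \<le> 2 * (m + N\<^sub>0) \<Longrightarrow> mtheta (c\<^sup>2 * q ^ s) p \<noteq> 0"
      unfolding subset_iff mem_ball mem_Collect_eq by (metis dist_commute)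
    have nz_c: "c \<noteq> 0" "den c \<noteq> 0" using r(2)[OF c(1)] by auto
    then have "theta_fact (c * x * q) q p (m + N\<^sub>0) \<noteq> 0" "theta_fact (c * q / x) q p (m + N\<^sub>0) \<noteq> 0"
      by (auto simp: den_def theta_facts_def)
    from theta_expansion_generic[OF p q nz_c(1) x A this qn c(2) f] have "lhs c = rhs c"
      unfolding lhs_def rhs_def .
    then show False using r(2)[OF c(1)] by simp
  qed
  then show ?thesis unfolding lhs_def rhs_def .
qed

end
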